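(* Let $\nu>0$ and $0<b<c$. Let $(R_u^{(\nu)})_{u\ge 0}$ be the Bessel process of index $\nu$ (equivalently, of dimension $2(1+\nu)$) started at $R_0^{(\nu)}=1$. Let $$\sigma:=\inf\Big\{u\ge 0 : (R_u^{(\nu)})^2=\tfrac1c\,(b+u)\Big\}.$$ Then for every real $s\ge 0$, $$E\big[(b+\sigma)^{-s}\big]=c^{-s}\,\frac{E\big[(1+2b\,\gamma_{s})^{-s+\nu}\big]}{E\big[(1+2c\,\gamma_{s})^{-s+\nu}\big]},$$ where $\gamma_{s}$ denotes a gamma random variable with parameter $s$ (with $\gamma_0:=0$).
   Context: For $\nu>0$, the Bessel process of index $\nu$ (dimension $2(1+\nu)$) started at $1$ is the $\mathbb{R}_+$-valued diffusion $(R_u^{(\nu)})_{u\ge0}$ with infinitesimal generator $$\mathcal{L}^{(\nu)}f(x)=\tfrac12 f''(x)+\frac{1+2\nu}{2x}f'(x),\qquad f\in C_b^2((0,\infty)).$$ For $a>0$, $\gamma_a$ denotes a gamma random variable with parameter $a$, i.e. with density $\frac{1}{\Gamma(a)}x^{a-1}e^{-x}$ on $(0,\infty)$; for $a=0$ the convention is $\gamma_0:=0$ (a degenerate random variable). In the case $s=0$, $(b+\sigma)^{-s}$ is understood as $\mathbf{1}_{\{\sigma<\infty\}}$; for $s>0$, $(b+\sigma)^{-s}:=0$ on $\{\sigma=\infty\}$. *)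

theory Defs
  imports "HOL-Probability.Probability"
begin

section \<open>The Bessel process of index \<nu>\<close>

text \<open>The state space is the closed half line with its Borel sets.\<close>

abbreviation half_line :: "real measure" where
  "half_line \<equiv> restrict_space borel {0..}"

text \<open>Time-homogeneous, conservative, jointly measurable transition functions on the half line.
  The first argument of \<open>P\<close> is the time, the second one the starting point; values of \<open>P\<close> at
  negative arguments are irrelevant.\<close>

definition transition_function :: "(real \<Rightarrow> real \<Rightarrow> real measure) \<Rightarrow> bool" where
  "transition_function P \<longleftrightarrow>
     (\<lambda>(t, x). P t x) \<in> half_line \<Otimes>\<^sub>M half_line \<rightarrow>\<^sub>M prob_algebra half_line \<and>
     (\<forall>x\<ge>0. P 0 x = return half_line x) \<and>
     (\<forall>s\<ge>0. \<forall>t\<ge>0. \<forall>x\<ge>0. P (s + t) x = P s x \<bind> P t)"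

definition natural_filtration :: "'w measure \<Rightarrow> (real \<Rightarrow> 'w \<Rightarrow> real) \<Rightarrow> real \<Rightarrow> 'w measure" where
  "natural_filtration M R t =
     sigma (space M) {R u -` A \<inter> space M | u A. 0 \<le> u \<and> u \<le> t \<and> A \<in> sets half_line}"

definition markov_process ::
    "'w measure \<Rightarrow> (real \<Rightarrow> real \<Rightarrow> real measure) \<Rightarrow> (real \<Rightarrow> 'w \<Rightarrow> real) \<Rightarrow> bool" where
  "markov_process M P R \<longleftrightarrow>
     (\<forall>u\<ge>0. R u \<in> M \<rightarrow>\<^sub>M half_line) \<and>
     (\<forall>s\<ge>0. \<forall>t\<ge>0. \<forall>A\<in>sets half_line. AE \<omega> in M.
        real_cond_exp M (natural_filtration M R s) (\<lambda>\<omega>. indicator A (R (s + t) \<omega>)) \<omega>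
          = measure (P t (R s \<omega>)) A)"

text \<open>Twice continuously differentiable functions on the open half line which are bounded together
  with their first two derivatives. Values outside the open half line are irrelevant.\<close>

definition Cb2 :: "(real \<Rightarrow> real) set" where
  "Cb2 = {f. f differentiable_on {0<..} \<and> deriv f differentiable_on {0<..} \<and>
             continuous_on {0<..} (deriv (deriv f)) \<and>
             bounded (f ` {0<..}) \<and> bounded (deriv f ` {0<..}) \<and>
             bounded (deriv (deriv f) ` {0<..})}"

definition bessel_operator :: "real \<Rightarrow> (real \<Rightarrow> real) \<Rightarrow> real \<Rightarrow> real" where
  "bessel_operator \<nu> f x = 1 / 2 * deriv (deriv f) x + (1 + 2 * \<nu>) / (2 * x) * deriv f x"

text \<open>That a diffusion with transition function \<open>P\<close> has infinitesimal generator \<open>L\<close> is understood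
  as in Revuz and Yor, Continuous Martingales and Brownian Motion, Definition VII.2.1: for every
  test function \<open>f\<close> and every starting point \<open>x\<close>,
  the identity \<open>P t f x = f x + (integral of P s (L f) x over s from 0 to t)\<close> holds.
  Since \<open>f' y / y\<close> may be unbounded near 0, the integrability of the right-hand side is part of
  the requirement. The choice of a constant \<open>f\<close> shows that the point 0 is not charged by \<open>P t x\<close>
  for positive \<open>x\<close>.\<close>

definition has_bessel_generator :: "real \<Rightarrow> (real \<Rightarrow> real \<Rightarrow> real measure) \<Rightarrow> bool" where
  "has_bessel_generator \<nu> P \<longleftrightarrow>
     (\<forall>f\<in>Cb2. \<forall>x>0. \<forall>t\<ge>0.
        (\<integral>\<^sup>+s\<in>{0..t}. (\<integral>\<^sup>+y\<in>{0<..}. ennreal \<bar>bessel_operator \<nu> f y\<bar> \<partial>P s x) \<partial>lborel) < \<infinity> \<and>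
        (LINT y:{0<..}|P t x. f y)
          = f x + (LINT s:{0..t}|lborel. (LINT y:{0<..}|P s x. bessel_operator \<nu> f y)))"

definition bessel_process ::
    "'w measure \<Rightarrow> real \<Rightarrow> real \<Rightarrow> (real \<Rightarrow> 'w \<Rightarrow> real) \<Rightarrow> bool" where
  "bessel_process M \<nu> x0 R \<longleftrightarrow>
     prob_space M \<and>
     (\<exists>P. transition_function P \<and> has_bessel_generator \<nu> P \<and> markov_process M P R) \<and>
     (\<forall>\<omega>\<in>space M. continuous_on {0..} (\<lambda>u. R u \<omega>)) \<and>
     (AE \<omega> in M. R 0 \<omega> = x0)"

section \<open>The hitting time and the gamma distribution\<close>

text \<open>The infimum is taken in the extended reals, so it is \<open>\<infinity>\<close> if the boundary is never hit.\<close>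

definition hitting_time :: "real \<Rightarrow> real \<Rightarrow> (real \<Rightarrow> 'w \<Rightarrow> real) \<Rightarrow> 'w \<Rightarrow> ereal" where
  "hitting_time b c R \<omega> = Inf {ereal u | u. 0 \<le> u \<and> (R u \<omega>)\<^sup>2 = 1 / c * (b + u)}"

text \<open>\<open>neg_power b s \<tau>\<close> is the power of \<open>b + \<tau>\<close> with exponent \<open>-s\<close>, read as 0 for \<open>\<tau> = \<infinity>\<close>. For
  \<open>s = 0\<close> and \<open>b > 0\<close> it is the indicator of \<open>\<tau> < \<infinity>\<close>, because \<open>r powr 0 = 1\<close> for \<open>r \<noteq> 0\<close>.\<close>

definition neg_power :: "real \<Rightarrow> real \<Rightarrow> ereal \<Rightarrow> real" where
  "neg_power b s \<tau> = (if \<tau> = \<infinity> then 0 else (b + real_of_ereal \<tau>) powr (- s))"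

definition gamma_law :: "real \<Rightarrow> real measure" where
  "gamma_law a =
     (if a = 0 then return borel 0
      else density lborel
        (\<lambda>x. ennreal (if 0 < x then 1 / Gamma a * x powr (a - 1) * exp (- x) else 0)))"

end

theory Submission
  imports Defs "HOL-Real_Asymp.Real_Asymp"
begin

text \<open>
  With \<open>p = \<nu> - s\<close>, the function \<open>g(x, t) = \<integral> w powr (s - 1) * (1 + 2 * (b + t) * w) powr p * exp (- w * x\<^sup>2) dw\<close>
  over \<open>w > 0\<close> is space-time harmonic for the Bessel generator, and substituting \<open>w \<mapsto> w / x\<^sup>2\<close> gives
  \<open>g(x, t) = x powr (- 2 * s) * Gamma s * E[(1 + 2 * \<gamma>\<^sub>s * (b + t) / x\<^sup>2) powr p]\<close>, which depends on \<open>b + t\<close> only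
  through the factor \<open>((b + t) / c) powr (- s)\<close> on the boundary \<open>c * x\<^sup>2 = b + t\<close>. Optional stopping at \<open>\<sigma>\<close>
  yields the formula for \<open>s > 0\<close>, and \<open>s \<down> 0\<close> gives the remaining case.

  Since \<open>g\<close> blows up at \<open>x = 0\<close>, the integral is cut off at \<open>w \<le> N\<close>. The cut-off function is bounded,
  and it fails to be harmonic only by the boundary term of an integration by parts in \<open>w\<close>, which is
  exponentially small in \<open>N\<close> as long as \<open>x\<^sup>2 \<ge> b / c\<close>. Optional stopping is carried out on a time grid,
  where it needs only the Markov property and a one-step estimate with an error quadratic in the
  mesh; the latter comes from applying the generator twice to \<open>exp (- w * x\<^sup>2)\<close>.
\<close>

section \<open>The generator on Gaussian test functions\<close>

text \<open>The hypotheses give the generator identity for the kernel on \<open>Cb2\<close> and the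
  Markov property at fixed times, but no stochastic calculus. The limits are therefore taken in a
  fixed order: mesh to 0 with cut-off N and horizon T fixed, then N = T to infinity together, then s
  to 0. The joint limit works because the accumulated error is at most T times
  \<open>exit_error\<close>, a quantity of polynomial growth times exp(- N * b / c). Gaussians are
  the building blocks because both they and their images under the generator lie in
  \<open>Cb2\<close>: their first derivatives are odd in y, so a factor y cancels the singular 1 /
  y, and all bounds are uniform in space. The exponent p = \<nu> - s makes the spatial drift and the
  time derivative add up to an exact derivative in w. The assumption b < c puts the starting point
  strictly above the boundary, so c * x^2 > b + t \<ge> b until the first hit, which keeps the path
  away from 0. Paths that never hit contribute 0 in the limit, since their stopped values decay like
  a negative power of the horizon; that almost every path hits comes out of s to 0.\<close>

lemma Cb2I:
  fixes f f' f'' :: "real \<Rightarrow> real"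
  assumes f: "\<And>y. y > 0 \<Longrightarrow> (f has_real_derivative f' y) (at y)"
    and f': "\<And>y. y > 0 \<Longrightarrow> (f' has_real_derivative f'' y) (at y)"
    and cont: "continuous_on {0<..} f''"
    and bdd: "bounded (f ` {0<..})" "bounded (f' ` {0<..})" "bounded (f'' ` {0<..})"
  shows "f \<in> Cb2"
    and "\<And>\<nu> y. y > 0 \<Longrightarrow> bessel_operator \<nu> f y = f'' y / 2 + (1 + 2 * \<nu>) / (2 * y) * f' y"
proof -
  have d1: "deriv f y = f' y" if "y > 0" for y
    using DERIV_imp_deriv[OF f[OF that]] .
  have df': "(deriv f has_real_derivative f'' y) (at y)" if "y > 0" for y
    by (rule has_field_derivative_transform_within_open[OF f'[OF that], of "{0<..}"])
       (use that d1 in auto)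
  have d2: "deriv (deriv f) y = f'' y" if "y > 0" for y
    using DERIV_imp_deriv[OF df'[OF that]] .
  have "f differentiable_on {0<..}" "deriv f differentiable_on {0<..}"
    using f df' by (auto intro!: differentiable_at_imp_differentiable_on
        simp: real_differentiable_def differentiable_def has_field_derivative_def) blast+
  moreover have "continuous_on {0<..} (deriv (deriv f))"
    using continuous_on_cong[of "{0<..}" "{0<..}" f'' "deriv (deriv f)"] cont d2 by auto
  moreover have "deriv f ` {0<..} = f' ` {0<..}" "deriv (deriv f) ` {0<..} = f'' ` {0<..}"
    using d1 d2 by (auto intro!: image_cong)
  ultimately show "f \<in> Cb2"
    using bdd by (auto simp: Cb2_def)
  show "bessel_operator \<nu> f y = f'' y / 2 + (1 + 2 * \<nu>) / (2 * y) * f' y" if "y > 0" for \<nu> y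
    using that by (simp add: bessel_operator_def d1 d2)
qed

text \<open>Raising q \<le> exp q to the power k + 1 bounds y^(2(k+1)) times the Gaussian; the power
  k itself follows from |y|^k \<le> 1 + y^(2(k+1)).\<close>

lemma bounded_monom_gaussian:
  fixes w :: real
  assumes "w > 0"
  shows "bounded ((\<lambda>y::real. y ^ k * exp (- (w * y\<^sup>2))) ` S)"
proof -
  have "\<bar>y ^ k * exp (- (w * y\<^sup>2))\<bar> \<le> 1 + (real (Suc k) / w) ^ Suc k" for y :: real
  proof -
    \<comment> \<open>The divisor \<open>Suc k\<close> makes \<open>exp q ^ Suc k\<close> the
      reciprocal of the Gaussian.\<close>
    define q where "q = w * y\<^sup>2 / real (Suc k)"
    have "q \<le> exp q" using exp_ge_add_one_self[of q] by linarith
    moreover have "q \<ge> 0" using assms by (simp add: q_def)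
    ultimately have "q ^ Suc k \<le> exp q ^ Suc k" by (intro power_mono)
    also have "exp q ^ Suc k = exp (w * y\<^sup>2)"
      by (simp add: exp_of_nat_mult[symmetric] q_def del: power_Suc of_nat_Suc)
    finally have "q ^ Suc k * exp (- (w * y\<^sup>2)) \<le> 1"
      by (simp add: exp_minus field_simps del: power_Suc)
    then have "(real (Suc k) / w) ^ Suc k * (q ^ Suc k * exp (- (w * y\<^sup>2)))
        \<le> (real (Suc k) / w) ^ Suc k"
      using assms by (intro mult_left_le) auto
    moreover have "(real (Suc k) / w) ^ Suc k * q ^ Suc k = (y\<^sup>2) ^ Suc k"
      unfolding power_mult_distrib[symmetric] q_def using assms by (simp del: power_Suc)
    ultimately have 1: "(y\<^sup>2) ^ Suc k * exp (- (w * y\<^sup>2)) \<le> (real (Suc k) / w) ^ Suc k"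
      by (simp only: mult.assoc[symmetric])
    have "\<bar>y\<bar> ^ k \<le> 1 + (y\<^sup>2) ^ Suc k"
    proof (cases "\<bar>y\<bar> \<le> 1")
      case True
      then have "\<bar>y\<bar> ^ k \<le> 1" by (intro power_le_one) auto
      then show ?thesis by (smt (verit) zero_le_power zero_le_power2)
    next
      case False
      then have "\<bar>y\<bar> ^ k \<le> \<bar>y\<bar> ^ (2 * Suc k)" by (intro power_increasing) auto
      also have "\<dots> = (y\<^sup>2) ^ Suc k" by (simp only: power_mult power2_abs)
      finally show ?thesis by simp
    qed
    then have "\<bar>y\<bar> ^ k * exp (- (w * y\<^sup>2)) \<le> (1 + (y\<^sup>2) ^ Suc k) * exp (- (w * y\<^sup>2))"
      by (intro mult_right_mono) auto
    also have "\<dots> \<le> 1 + (real (Suc k) / w) ^ Suc k"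
      using 1 assms by (simp add: distrib_right del: power_Suc) (smt (verit) exp_le_one_iff mult_nonneg_nonneg zero_le_power2)
    finally show ?thesis by (simp add: abs_mult power_abs)
  qed
  then show ?thesis by (auto simp: bounded_iff)
qed

lemma bounded_times_const:
  fixes f :: "'a \<Rightarrow> real"
  shows "bounded (f ` S) \<Longrightarrow> bounded ((\<lambda>x. c * f x) ` S)"
  using bounded_scaling[of "f ` S" c] by (simp add: image_image)

text \<open>Every derivative of a Gaussian is a polynomial times the same Gaussian, so this settles
  all boundedness conditions of \<open>Cb2\<close> below.\<close>

lemma bounded_poly_gaussian:
  fixes w :: real
  assumes "w > 0"
  shows "bounded ((\<lambda>y::real. poly p y * exp (- (w * y\<^sup>2))) ` S)"
proof -
  have "bounded ((\<lambda>y::real. (\<Sum>i\<le>n. coeff p i * (y ^ i * exp (- (w * y\<^sup>2))))) ` S)" for n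
  proof (induction n)
    case 0
    show ?case
      using bounded_times_const[OF bounded_monom_gaussian[OF assms, of 0 S], of "coeff p 0"] by simp
  next
    case (Suc n)
    show ?case
      using bounded_plus_comp[OF Suc
          bounded_times_const[OF bounded_monom_gaussian[OF assms, of "Suc n" S], of "coeff p (Suc n)"]]
      by simp
  qed
  from this[of "degree p"] show ?thesis
    by (simp add: poly_altdef sum_distrib_right mult.assoc)
qed

lemma power_times_exp_minus_le:
  fixes q :: real
  assumes "q \<ge> 0"
  shows "q * exp (- q) \<le> 1" "q\<^sup>2 * exp (- q) \<le> 2"
proof -
  show "q * exp (- q) \<le> 1"
    using exp_ge_add_one_self[of q] by (simp add: exp_minus field_simps del: exp_ge_add_one_self)
  have "1 + q + q\<^sup>2 / 2 \<le> exp q"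
    using exp_lower_Taylor_quadratic[OF assms] by simp
  with assms show "q\<^sup>2 * exp (- q) \<le> 2"
    by (simp add: exp_minus field_simps)
qed

text \<open>The Bessel generator applied to y \<mapsto> exp(- w y^2). The first derivative has a
  factor y that cancels 1 / y, so the result stays bounded near 0.\<close>

definition gaussian_drift :: "real \<Rightarrow> real \<Rightarrow> real \<Rightarrow> real" where
  "gaussian_drift \<nu> w y = (2 * w\<^sup>2 * y\<^sup>2 - 2 * (\<nu> + 1) * w) * exp (- (w * y\<^sup>2))"

text \<open>With q = w y^2, the generator applied to \<open>gaussian_drift\<close> is w^2 exp(- q)
  times a quadratic polynomial in q. The three summands bound its three terms, using q^2 exp(- q)
  \<le> 2, q exp(- q) \<le> 1 and exp(- q) \<le> 1.\<close>

definition drift_bound :: "real \<Rightarrow> real" where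
  "drift_bound \<nu> = 8 + (8 * \<nu> + 16) + 4 * (\<nu> + 1) * (\<nu> + 2)"

lemma gaussian_Cb2:
  assumes w: "w > 0"
  shows "(\<lambda>y. exp (- (w * y\<^sup>2))) \<in> Cb2"
    and "\<And>y. y > 0 \<Longrightarrow> bessel_operator \<nu> (\<lambda>y. exp (- (w * y\<^sup>2))) y = gaussian_drift \<nu> w y"
proof -
  let ?p = "[:0, - 2 * w:]" and ?q = "[:- 2 * w, 0, 4 * w\<^sup>2:]"
  have D: "((\<lambda>y. exp (- (w * y\<^sup>2))) has_real_derivative poly ?p y * exp (- (w * y\<^sup>2))) (at y)"
    "((\<lambda>y. poly ?p y * exp (- (w * y\<^sup>2))) has_real_derivative poly ?q y * exp (- (w * y\<^sup>2))) (at y)"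
    for y
    by (auto intro!: derivative_eq_intros simp: algebra_simps power2_eq_square)
  have B: "bounded ((\<lambda>y. exp (- (w * y\<^sup>2))) ` {0<..})"
    using bounded_poly_gaussian[OF w, of "[:1:]"] by simp
  note C = Cb2I[OF D _ B bounded_poly_gaussian[OF w] bounded_poly_gaussian[OF w]]
  show "(\<lambda>y. exp (- (w * y\<^sup>2))) \<in> Cb2"
    by (rule C) (intro continuous_intros)
  show "bessel_operator \<nu> (\<lambda>y. exp (- (w * y\<^sup>2))) y = gaussian_drift \<nu> w y" if "y > 0" for y
    by (subst C(2)) (use that in \<open>auto intro!: continuous_intros
        simp: gaussian_drift_def field_simps power2_eq_square\<close>)
qed

text \<open>The second application of the generator. The drift is an even polynomial times a
  Gaussian, so its derivative again carries a factor y against 1 / y; the bound is uniform in y and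
  of order w^2.\<close>

lemma gaussian_drift_Cb2:
  assumes w: "w > 0" and \<nu>: "\<nu> > 0"
  shows "gaussian_drift \<nu> w \<in> Cb2"
    and "\<And>y. y > 0 \<Longrightarrow> \<bar>bessel_operator \<nu> (gaussian_drift \<nu> w) y\<bar> \<le> drift_bound \<nu> * w\<^sup>2"
proof -
  \<comment> \<open>The polynomial factors of the drift and of its first and second derivatives,
    once the Gaussian is split off.\<close>
  let ?r = "[:- 2 * (\<nu> + 1) * w, 0, 2 * w\<^sup>2:]"
  let ?p = "[:0, 4 * (\<nu> + 2) * w\<^sup>2, 0, - 4 * w ^ 3:]"
  let ?q = "[:4 * (\<nu> + 2) * w\<^sup>2, 0, - 4 * w ^ 3 - 8 * (\<nu> + 3) * w ^ 3, 0, 8 * w ^ 4:]"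
  have eq: "gaussian_drift \<nu> w = (\<lambda>y. poly ?r y * exp (- (w * y\<^sup>2)))"
    by (auto simp: gaussian_drift_def fun_eq_iff algebra_simps power2_eq_square)
  have D: "(gaussian_drift \<nu> w has_real_derivative poly ?p y * exp (- (w * y\<^sup>2))) (at y)"
    "((\<lambda>y. poly ?p y * exp (- (w * y\<^sup>2))) has_real_derivative poly ?q y * exp (- (w * y\<^sup>2))) (at y)"
    for y unfolding eq
    by (auto intro!: derivative_eq_intros simp: algebra_simps power2_eq_square power3_eq_cube power4_eq_xxxx)
  have B: "bounded (gaussian_drift \<nu> w ` {0<..})"
    unfolding eq by (rule bounded_poly_gaussian[OF w])
  note C = Cb2I[OF D _ B bounded_poly_gaussian[OF w] bounded_poly_gaussian[OF w]]
  show "gaussian_drift \<nu> w \<in> Cb2"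
    by (rule C) (intro continuous_intros)
  fix y :: real assume y: "y > 0"
  define q where "q = w * y\<^sup>2"
  have q: "q \<ge> 0" using w by (simp add: q_def)
  have "bessel_operator \<nu> (gaussian_drift \<nu> w) y
      = w\<^sup>2 * (4 * (q\<^sup>2 * exp (- q)) - (8 * \<nu> + 16) * (q * exp (- q)) + 4 * (\<nu> + 1) * (\<nu> + 2) * exp (- q))"
    by (subst C(2)) (use y in \<open>auto intro!: continuous_intros
        simp: q_def field_simps power2_eq_square power3_eq_cube power4_eq_xxxx\<close>)
  also have "\<bar>\<dots>\<bar> \<le> w\<^sup>2 * drift_bound \<nu>"
    unfolding abs_mult
  proof (intro mult_mono)
    have arith: "\<bar>4 * X - Y + Z\<bar> \<le> 8 + A + B"
      if "0 \<le> X" "X \<le> 2" "0 \<le> Y" "Y \<le> A" "0 \<le> Z" "Z \<le> B" for X Y Z A B :: real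
      using that by linarith
    have 1: "0 \<le> q * exp (- q)" "0 \<le> q\<^sup>2 * exp (- q)" "exp (- q) \<le> 1"
      using q by auto
    have 2: "(8 * \<nu> + 16) * (q * exp (- q)) \<le> (8 * \<nu> + 16) * 1"
      using \<nu> q by (intro mult_left_mono power_times_exp_minus_le) auto
    have 3: "4 * (\<nu> + 1) * (\<nu> + 2) * exp (- q) \<le> 4 * (\<nu> + 1) * (\<nu> + 2) * 1"
      using \<nu> 1 by (intro mult_left_mono) auto
    have 4: "0 \<le> (8 * \<nu> + 16) * (q * exp (- q))" "0 \<le> 4 * (\<nu> + 1) * (\<nu> + 2) * exp (- q)"
      "0 \<le> 4 * (\<nu> + 1) * (\<nu> + 2)" "0 \<le> 8 * \<nu> + 16"
      using \<nu> 1 by auto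
    show "\<bar>4 * (q\<^sup>2 * exp (- q)) - (8 * \<nu> + 16) * (q * exp (- q)) + 4 * (\<nu> + 1) * (\<nu> + 2) * exp (- q)\<bar>
        \<le> drift_bound \<nu>"
      unfolding drift_bound_def
      by (intro arith 1 4 power_times_exp_minus_le q 2[unfolded mult_1_right] 3[unfolded mult_1_right])
  qed auto
  finally show "\<bar>bessel_operator \<nu> (gaussian_drift \<nu> w) y\<bar> \<le> drift_bound \<nu> * w\<^sup>2"
    by (simp add: mult.commute)
qed

section \<open>Truncated Laplace mixtures\<close>

text \<open>The gamma density without its exponential, cut off at N. The exponential stays in the
  integrand, where the space variable enters as exp(- w x^2).\<close>

definition power_measure :: "real \<Rightarrow> real \<Rightarrow> real measure" where
  "power_measure s N = density lborel (\<lambda>w. ennreal (indicator {0<..N} w * w powr (s - 1)))"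

lemma sets_power_measure [simp, measurable_cong]: "sets (power_measure s N) = sets borel"
  by (simp add: power_measure_def)

lemma space_power_measure [simp]: "space (power_measure s N) = UNIV"
  by (simp add: power_measure_def)

lemma AE_power_measure: "AE w in power_measure s N. 0 < w \<and> w \<le> N"
  unfolding power_measure_def
  by (subst AE_density) (auto intro!: AE_I2 split: split_indicator simp: ennreal_eq_0_iff)

lemma integral_power_measure:
  fixes f :: "real \<Rightarrow> real"
  assumes "f \<in> borel_measurable borel"
  shows "(\<integral>w. f w \<partial>power_measure s N) = (\<integral>w. indicator {0<..N} w * w powr (s - 1) * f w \<partial>lborel)"
  unfolding power_measure_def using assms
  by (subst integral_density) (auto intro!: AE_I2 split: split_indicator)

lemma integrable_power_measure_iff:
  fixes f :: "real \<Rightarrow> real"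
  assumes "f \<in> borel_measurable borel"
  shows "integrable (power_measure s N) f
    \<longleftrightarrow> integrable lborel (\<lambda>w. indicator {0<..N} w * w powr (s - 1) * f w)"
  unfolding power_measure_def using assms
  by (subst integrable_density) (auto intro!: AE_I2 split: split_indicator)

text \<open>The singularity of w^(s-1) at 0 is integrable because s > 0, and the cut-off removes the
  other end. From here on bounded integrands are integrable and constants serve as dominating
  functions.\<close>

lemma finite_measure_power_measure:
  assumes s: "s > 0"
  shows "finite_measure (power_measure s N)"
proof
  have "(\<lambda>w. w powr (s - 1)) integrable_on {0..max 0 N}"
    using s by (intro integrable_on_powr_from_0) auto
  then have "(\<lambda>w. w powr (s - 1)) absolutely_integrable_on {0..max 0 N}"
    by (subst absolutely_integrable_on_iff_nonneg) auto
  then have "integrable lborel (\<lambda>w. indicator {0..max 0 N} w *\<^sub>R w powr (s - 1))"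
    unfolding set_integrable_def by (subst (asm) integrable_completion) auto
  then have "integrable lborel (\<lambda>w. indicator {0<..N} w * w powr (s - 1))"
    by (rule Bochner_Integration.integrable_bound) (auto split: split_indicator)
  then have "(\<integral>\<^sup>+w. ennreal (indicator {0<..N} w * w powr (s - 1)) \<partial>lborel) < \<infinity>"
    by (subst (asm) integrable_iff_bounded) (auto simp: abs_mult)
  then show "emeasure (power_measure s N) (space (power_measure s N)) \<noteq> \<infinity>"
    by (simp add: power_measure_def emeasure_density)
qed

lemma integrable_power_measure:
  fixes f :: "real \<Rightarrow> real"
  assumes "s > 0" "f \<in> borel_measurable borel" "\<And>w. 0 < w \<Longrightarrow> w \<le> N \<Longrightarrow> \<bar>f w\<bar> \<le> B"
  shows "integrable (power_measure s N) f"
proof -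
  interpret finite_measure "power_measure s N" using assms(1) by (rule finite_measure_power_measure)
  show ?thesis
    by (rule integrable_const_bound[of _ B])
       (use assms in \<open>auto intro!: eventually_mono[OF AE_power_measure]\<close>)
qed

lemma integral_power_measure_le:
  fixes f :: "real \<Rightarrow> real"
  assumes s: "s > 0" and B: "B \<ge> 0" "\<And>w. 0 < w \<Longrightarrow> w \<le> N \<Longrightarrow> \<bar>f w\<bar> \<le> B"
  shows "\<bar>\<integral>w. f w \<partial>power_measure s N\<bar> \<le> B * measure (power_measure s N) UNIV"
proof -
  interpret finite_measure "power_measure s N" using assms(1) by (rule finite_measure_power_measure)
  have "\<bar>\<integral>w. f w \<partial>power_measure s N\<bar> \<le> (\<integral>w. \<bar>f w\<bar> \<partial>power_measure s N)"
    by (rule integral_abs_bound)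
  also have "\<dots> \<le> (\<integral>w. B \<partial>power_measure s N)"
    by (rule integral_mono_AE')
       (use B in \<open>auto intro!: eventually_mono[OF AE_power_measure]\<close>)
  finally show ?thesis by (simp add: mult.commute)
qed

text \<open>A single bound for the exponents p, p - 1 and p - 2 that occur below, whatever the sign
  of p: the base is at least 1, so both the exponent and the base may be enlarged.\<close>

lemma powr_between:
  fixes u L p q :: real
  assumes "1 \<le> u" "u \<le> L" "q \<le> p"
  shows "u powr q \<le> L powr \<bar>p\<bar>"
proof -
  have "u powr q \<le> u powr \<bar>p\<bar>" using assms by (intro powr_mono) auto
  also have "\<dots> \<le> L powr \<bar>p\<bar>" using assms by (intro powr_mono2) auto
  finally show ?thesis .
qed

text \<open>Second-order Taylor expansion in time around the later time \<tau>, evaluated one step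
  earlier. The error is uniform in w \<le> N and \<tau> \<le> U.\<close>

lemma affine_powr_taylor:
  fixes p \<tau> \<delta> w N U :: real
  assumes w: "0 < w" "w \<le> N" and \<tau>: "0 \<le> \<tau> - \<delta>" "\<tau> \<le> U" and \<delta>: "0 \<le> \<delta>"
  shows "\<bar>(1 + 2 * (\<tau> - \<delta>) * w) powr p - (1 + 2 * \<tau> * w) powr p + \<delta> * (2 * w * p * (1 + 2 * \<tau> * w) powr (p - 1))\<bar>
    \<le> 2 * N\<^sup>2 * \<bar>p * (p - 1)\<bar> * (1 + 2 * U * N) powr \<bar>p\<bar> * \<delta>\<^sup>2"
proof (cases "\<delta> = 0")
  case False
  \<comment> \<open>The derivatives in t of order 0, 1 and 2. Half of the constant 4 in the second
    one gives the constant 2 of the error bound.\<close>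
  define diff where "diff m t = (if m = 0 then (1 + 2 * t * w) powr p
      else if m = 1 then 2 * w * p * (1 + 2 * t * w) powr (p - 1)
      else 4 * w\<^sup>2 * p * (p - 1) * (1 + 2 * t * w) powr (p - 2))" for m :: nat and t :: real
  have pos: "1 + 2 * t * w \<ge> 1" if "t \<ge> 0" for t using that w by simp
  have "\<exists>t. \<tau> - \<delta> < t \<and> t < \<tau> \<and> (\<lambda>t. (1 + 2 * t * w) powr p) (\<tau> - \<delta>)
      = (\<Sum>m<2. (diff m \<tau> / fact m) * (\<tau> - \<delta> - \<tau>) ^ m) + (diff 2 t / fact 2) * (\<tau> - \<delta> - \<tau>) ^ 2"
  proof (rule Taylor_down)
    show "\<forall>m t. m < 2 \<and> \<tau> - \<delta> \<le> t \<and> t \<le> \<tau> \<longrightarrow> DERIV (diff m) t :> diff (Suc m) t"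
    proof (intro allI impI)
      fix m :: nat and t assume "m < 2 \<and> \<tau> - \<delta> \<le> t \<and> t \<le> \<tau>"
      then have m: "m = 0 \<or> m = 1" and t: "1 + 2 * t * w > 0"
        using \<tau> pos[of t] by auto
      from m show "DERIV (diff m) t :> diff (Suc m) t"
        unfolding diff_def using t
        by (elim disjE; simp only: if_True if_False one_neq_zero refl)
           (auto intro!: derivative_eq_intros simp: power2_eq_square)
    qed
  qed (use False \<delta> in \<open>auto simp: diff_def\<close>)
  then obtain t where t: "\<tau> - \<delta> < t" "t < \<tau>"
    and eq: "(1 + 2 * (\<tau> - \<delta>) * w) powr p
      = (\<Sum>m<2. (diff m \<tau> / fact m) * (\<tau> - \<delta> - \<tau>) ^ m) + (diff 2 t / fact 2) * (\<tau> - \<delta> - \<tau>) ^ 2"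
    by blast
  have "(1 + 2 * (\<tau> - \<delta>) * w) powr p - (1 + 2 * \<tau> * w) powr p + \<delta> * (2 * w * p * (1 + 2 * \<tau> * w) powr (p - 1))
      = 2 * w\<^sup>2 * (p * (p - 1)) * (1 + 2 * t * w) powr (p - 2) * \<delta>\<^sup>2"
    unfolding eq by (simp add: diff_def eval_nat_numeral field_simps)
  moreover have "w\<^sup>2 * (1 + 2 * t * w) powr (p - 2) \<le> N\<^sup>2 * (1 + 2 * U * N) powr \<bar>p\<bar>"
    using w t \<tau> by (intro mult_mono power_mono powr_between) (auto intro!: mult_mono)
  then have "(2 * \<bar>p * (p - 1)\<bar> * \<delta>\<^sup>2) * (w\<^sup>2 * (1 + 2 * t * w) powr (p - 2))
      \<le> (2 * \<bar>p * (p - 1)\<bar> * \<delta>\<^sup>2) * (N\<^sup>2 * (1 + 2 * U * N) powr \<bar>p\<bar>)"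
    by (intro mult_left_mono) auto
  ultimately show ?thesis by (simp add: abs_mult mult_ac)
qed simp

text \<open>\<open>D\<close> is the rate of change of the integrand: the spatial drift of the
  Gaussian plus the time derivative of the power. Multiplied by w^(s-1) it is the exact w-derivative
  of \<open>F\<close>, which vanishes at 0, so only the value at the cut-off remains. Letting that
  value tend to 0 is the space-time harmonicity of the untruncated integral.\<close>

lemma power_measure_drift_integral:
  fixes s \<nu> \<tau> x N :: real
  assumes s: "s > 0" and \<tau>: "\<tau> \<ge> 0" and N: "N > 0"
  defines "p \<equiv> \<nu> - s"
  defines "D \<equiv> \<lambda>w. (1 + 2 * \<tau> * w) powr p * gaussian_drift \<nu> w x
      + 2 * w * p * (1 + 2 * \<tau> * w) powr (p - 1) * exp (- (w * x\<^sup>2))"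
  assumes int: "integrable (power_measure s N) D"
  shows "(\<integral>w. D w \<partial>power_measure s N)
    = - 2 * N powr (s + 1) * (1 + 2 * \<tau> * N) powr p * exp (- (N * x\<^sup>2))"
proof -
  define F where "F w = - 2 * w powr (s + 1) * (1 + 2 * \<tau> * w) powr p * exp (- (w * x\<^sup>2))" for w
  have Dm: "D \<in> borel_measurable borel"
    unfolding D_def gaussian_drift_def by measurable
  have pos: "1 + 2 * \<tau> * w > 0" if "w \<ge> 0" for w
    using that \<tau> by (intro add_pos_nonneg) auto
  have "((\<lambda>w. w powr (s - 1) * D w) has_integral (F N - F 0)) {0..N}"
  proof (rule fundamental_theorem_of_calculus_interior)
    show "continuous_on {0..N} F"
      unfolding F_def using s pos
      by (intro continuous_intros continuous_on_powr') (auto simp: less_imp_neq[symmetric] pos order_less_imp_not_eq2)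
    fix w assume w: "w \<in> {0<..<N}"
    define A where "A = 1 + 2 * \<tau> * w"
    have A: "A > 0" using pos[of w] w by (simp add: A_def)
    have "(F has_real_derivative - 2 * exp (- (w * x\<^sup>2)) * ((s + 1) * w powr s * A powr p
        + w powr (s + 1) * (p * A powr (p - 1) * (2 * \<tau>)) - x\<^sup>2 * w powr (s + 1) * A powr p)) (at w)"
      unfolding F_def A_def using w pos[of w]
      by (auto intro!: derivative_eq_intros simp: algebra_simps)
    also have "- 2 * exp (- (w * x\<^sup>2)) * ((s + 1) * w powr s * A powr p
        + w powr (s + 1) * (p * A powr (p - 1) * (2 * \<tau>)) - x\<^sup>2 * w powr (s + 1) * A powr p)
      = w powr (s - 1) * D w"
    proof -
      have e: "w powr s = w powr (s - 1) * w" "w powr (s + 1) = w powr (s - 1) * w\<^sup>2"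
        "A powr p = A powr (p - 1) * A"
        using w A by (auto simp: powr_diff powr_add power2_eq_square)
      have "D w = exp (- (w * x\<^sup>2)) * (A powr p * (2 * w\<^sup>2 * x\<^sup>2 - 2 * (\<nu> + 1) * w) + 2 * w * p * A powr (p - 1))"
        by (simp add: D_def gaussian_drift_def A_def algebra_simps)
      \<comment> \<open>After w^(s-1), A^(p-1) and the exponential are factored out, a polynomial
        identity remains. It amounts to (\<nu> - s) A = p (1 + 2 \<tau> w), which is where p = \<nu>
        - s enters.\<close>
      moreover have "- 2 * ((s + 1) * w * A + w\<^sup>2 * (p * (2 * \<tau>)) - x\<^sup>2 * w\<^sup>2 * A)
        = A * (2 * w\<^sup>2 * x\<^sup>2 - 2 * (\<nu> + 1) * w) + 2 * w * p"
        unfolding p_def A_def by (simp add: algebra_simps power2_eq_square)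
      ultimately show ?thesis
        unfolding e by algebra
    qed
    finally show "(F has_vector_derivative w powr (s - 1) * D w) (at w)"
      by (simp add: has_real_derivative_iff_has_vector_derivative)
  qed (use N in auto)
  moreover have "F 0 = 0" by (simp add: F_def)
  ultimately have "integral {0..N} (\<lambda>w. w powr (s - 1) * D w) = F N"
    by (simp add: integral_unique)
  moreover
  \<comment> \<open>The two intervals differ only at w = 0, where \<open>0 powr (s - 1)\<close> is 0
    by convention, for s = 1 as well.\<close>
  have eq: "indicator {0<..N} w * w powr (s - 1) * D w = indicator {0..N} w *\<^sub>R (w powr (s - 1) * D w)" for w
    by (cases "w = 0") (auto split: split_indicator)
  have "set_integrable lborel {0..N} (\<lambda>w. w powr (s - 1) * D w)"
    using int unfolding integrable_power_measure_iff[OF Dm] set_integrable_def eq .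
  from set_borel_integral_eq_integral(2)[OF this]
  have "(\<integral>w. D w \<partial>power_measure s N) = integral {0..N} (\<lambda>w. w powr (s - 1) * D w)"
    unfolding integral_power_measure[OF Dm] set_lebesgue_integral_def eq .
  ultimately show ?thesis by (simp add: F_def)
qed

text \<open>The truncated version of g from the overview, with z in the role of x^2 and \<tau> in
  the role of b + t.\<close>

definition laplace_mix :: "real \<Rightarrow> real \<Rightarrow> real \<Rightarrow> real \<Rightarrow> real \<Rightarrow> real" where
  "laplace_mix p s N z \<tau> = (\<integral>w. (1 + 2 * \<tau> * w) powr p * exp (- (w * z)) \<partial>power_measure s N)"

lemma integrable_laplace_mix:
  assumes "s > 0" "z \<ge> 0" "\<tau> \<ge> 0"
  shows "integrable (power_measure s N) (\<lambda>w. (1 + 2 * \<tau> * w) powr p * exp (- (w * z)))"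
proof (rule integrable_power_measure[where B = "(1 + 2 * \<tau> * N) powr \<bar>p\<bar>"])
  fix w assume w: "0 < w" "w \<le> N"
  have "(1 + 2 * \<tau> * w) powr p * exp (- (w * z)) \<le> (1 + 2 * \<tau> * N) powr \<bar>p\<bar> * 1"
    using w assms by (intro mult_mono powr_between) (auto intro!: mult_mono)
  then show "\<bar>(1 + 2 * \<tau> * w) powr p * exp (- (w * z))\<bar> \<le> (1 + 2 * \<tau> * N) powr \<bar>p\<bar>" by simp
qed (use assms in measurable)

lemma laplace_mix_nonneg: "laplace_mix p s N z \<tau> \<ge> 0"
  unfolding laplace_mix_def by (intro integral_nonneg_AE AE_I2) auto

lemma laplace_mix_bound:
  assumes "s > 0" "z \<ge> 0" "0 \<le> \<tau>" "\<tau> \<le> U" "N > 0"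
  shows "laplace_mix p s N z \<tau> \<le> (1 + 2 * U * N) powr \<bar>p\<bar> * measure (power_measure s N) UNIV"
proof -
  have "\<bar>laplace_mix p s N z \<tau>\<bar> \<le> (1 + 2 * U * N) powr \<bar>p\<bar> * measure (power_measure s N) UNIV"
    unfolding laplace_mix_def
  proof (rule integral_power_measure_le)
    fix w assume w: "0 < w" "w \<le> N"
    have "(1 + 2 * \<tau> * w) powr p * exp (- (w * z)) \<le> (1 + 2 * U * N) powr \<bar>p\<bar> * 1"
      using w assms by (intro mult_mono powr_between) (auto intro!: mult_mono)
    then show "\<bar>(1 + 2 * \<tau> * w) powr p * exp (- (w * z))\<bar> \<le> (1 + 2 * U * N) powr \<bar>p\<bar>" by simp
  qed (use assms in auto)
  then show ?thesis by simp
qed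

lemma borel_measurable_laplace_mix:
  assumes "s > 0"
  shows "(\<lambda>z. laplace_mix p s N z \<tau>) \<in> borel_measurable borel"
proof -
  interpret finite_measure "power_measure s N" using assms by (rule finite_measure_power_measure)
  show ?thesis unfolding laplace_mix_def by measurable
qed

text \<open>Joint continuity in space and time, needed when grid times approach the exit time along
  a continuous path.\<close>

lemma tendsto_laplace_mix:
  assumes s: "s > 0" and N: "N > 0"
    and z: "Z \<longlonglongrightarrow> z" "\<And>n. Z n \<ge> 0" and \<tau>: "T \<longlonglongrightarrow> \<tau>" "\<And>n. 0 \<le> T n" "\<And>n. T n \<le> U"
  shows "(\<lambda>n. laplace_mix p s N (Z n) (T n)) \<longlonglongrightarrow> laplace_mix p s N z \<tau>"
  unfolding laplace_mix_def
proof (rule integral_dominated_convergence[where w = "\<lambda>_. (1 + 2 * U * N) powr \<bar>p\<bar>"])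
  have \<tau>0: "\<tau> \<ge> 0" using \<tau> by (meson LIMSEQ_le_const)
  show "integrable (power_measure s N) (\<lambda>_. (1 + 2 * U * N) powr \<bar>p\<bar>)"
    using s by (rule integrable_power_measure) auto
  show "AE w in power_measure s N. (\<lambda>n. (1 + 2 * T n * w) powr p * exp (- (w * Z n)))
      \<longlonglongrightarrow> (1 + 2 * \<tau> * w) powr p * exp (- (w * z))"
  proof (rule eventually_mono[OF AE_power_measure])
    fix w :: real assume w: "0 < w \<and> w \<le> N"
    then have "1 + 2 * \<tau> * w > 0" using \<tau>0 by (intro add_pos_nonneg) auto
    then show "(\<lambda>n. (1 + 2 * T n * w) powr p * exp (- (w * Z n)))
      \<longlonglongrightarrow> (1 + 2 * \<tau> * w) powr p * exp (- (w * z))"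
      using z \<tau> by (intro tendsto_intros) auto
  qed
  show "AE w in power_measure s N. norm ((1 + 2 * T n * w) powr p * exp (- (w * Z n)))
      \<le> (1 + 2 * U * N) powr \<bar>p\<bar>" for n
  proof (rule eventually_mono[OF AE_power_measure])
    fix w :: real assume w: "0 < w \<and> w \<le> N"
    have "(1 + 2 * T n * w) powr p * exp (- (w * Z n)) \<le> (1 + 2 * U * N) powr \<bar>p\<bar> * 1"
      using w z(2)[of n] \<tau>(2,3)[of n] by (intro mult_mono powr_between) (auto intro!: mult_mono)
    then show "norm ((1 + 2 * T n * w) powr p * exp (- (w * Z n))) \<le> (1 + 2 * U * N) powr \<bar>p\<bar>" by simp
  qed
qed auto

section \<open>Gamma integrals\<close>

text \<open>Gamma s times the expectation of (1 + 2 a \<gamma>)^p for a gamma variable with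
  parameter s. Leaving out the normalisation is harmless in a quotient.\<close>

definition gamma_mix :: "real \<Rightarrow> real \<Rightarrow> real \<Rightarrow> real" where
  "gamma_mix s p a = (\<integral>x. indicator {0<..} x * x powr (s - 1) * exp (- x) * (1 + 2 * a * x) powr p \<partial>lborel)"

text \<open>The normalisation is written with \<open>rGamma\<close> because this function is
  continuous at 0 with value 0, which drives the limit s to 0.\<close>

lemma gamma_law_integral:
  fixes f :: "real \<Rightarrow> real"
  assumes s: "s > 0" and f: "f \<in> borel_measurable borel"
  shows "(\<integral>x. f x \<partial>gamma_law s) = rGamma s * (\<integral>x. indicator {0<..} x * x powr (s - 1) * exp (- x) * f x \<partial>lborel)"
proof -
  have "(\<integral>x. f x \<partial>gamma_law s)
      = (\<integral>x. (if 0 < x then 1 / Gamma s * x powr (s - 1) * exp (- x) else 0) * f x \<partial>lborel)"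
    unfolding gamma_law_def using s f
    by (subst if_not_P, simp, subst integral_density) (auto intro!: AE_I2 simp: Gamma_real_pos less_imp_le)
  also have "\<dots> = (\<integral>x. rGamma s * (indicator {0<..} x * x powr (s - 1) * exp (- x) * f x) \<partial>lborel)"
    by (intro Bochner_Integration.integral_cong refl)
       (auto simp: indicator_def rGamma_inverse_Gamma field_simps)
  finally show ?thesis by simp
qed

text \<open>Source of the dominating functions: one half of the exponential decay secures
  integrability, the other half absorbs powers of 1 + 2 a x.\<close>

lemma integrable_powr_exp_half:
  assumes s: "s > 0"
  shows "integrable lborel (\<lambda>x::real. indicator {0<..} x * x powr (s - 1) * exp (- (x / 2)))"
proof -
  have "(\<lambda>t. complex_of_real t powr (complex_of_real s - 1) / of_real (exp (1 / 2 * t))) absolutely_integrable_on {0<..}"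
    using s by (intro absolutely_integrable_Gamma_integral) auto
  then have "integrable lebesgue (\<lambda>t. norm (indicator {0<..} t *\<^sub>R
      (complex_of_real t powr (complex_of_real s - 1) / of_real (exp (1 / 2 * t)))))"
    unfolding set_integrable_def by (rule integrable_norm)
  also have "(\<lambda>t. norm (indicator {0<..} t *\<^sub>R
      (complex_of_real t powr (complex_of_real s - 1) / of_real (exp (1 / 2 * t)))))
    = (\<lambda>x. indicator {0<..} x * x powr (s - 1) * exp (- (x / 2)))"
    by (auto simp: fun_eq_iff indicator_def norm_divide norm_powr_real_powr exp_minus field_simps)
  finally show ?thesis by (subst (asm) integrable_completion) auto
qed

lemma affine_powr_le_exp_half:
  fixes a q :: real
  assumes a: "a > 0" and q: "q > 0"
  shows "\<exists>C>0. \<forall>x\<ge>0. (1 + 2 * a * x) powr q \<le> C * exp (x / 2)"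
proof (intro exI conjI allI impI)
  \<comment> \<open>ln lies below its tangent at k. This choice of k gives q * ln(1 + 2 a x) a
    linear bound with slope 2 a q / k = 1/2 in x.\<close>
  define k where "k = 4 * a * q"
  have k: "k > 0" using a q by (simp add: k_def)
  fix x :: real assume x: "x \<ge> 0"
  have pos: "1 + 2 * a * x > 0" using a x by (intro add_pos_nonneg) auto
  have "ln ((1 + 2 * a * x) / k) \<le> (1 + 2 * a * x) / k - 1"
    using pos k by (intro ln_le_minus_one) auto
  then have "q * ln (1 + 2 * a * x) \<le> q * (ln k + (1 + 2 * a * x) / k)"
    using q pos k by (intro mult_left_mono) (auto simp: ln_div)
  also have "\<dots> = q * ln k + q / k + x / 2"
    using a q by (simp add: k_def field_simps)
  finally show "(1 + 2 * a * x) powr q \<le> exp (q * ln k + q / k) * exp (x / 2)"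
    using pos by (simp add: powr_def flip: exp_add)
qed simp

lemma integrable_gamma_mix:
  assumes s: "s > 0" and a: "a > 0"
  shows "integrable lborel (\<lambda>x::real. indicator {0<..} x * x powr (s - 1) * exp (- x) * (1 + 2 * a * x) powr p)"
proof -
  \<comment> \<open>The added 1 makes the exponent positive even for p = 0, as the estimate
    requires.\<close>
  obtain C where C: "C > 0" "\<And>x. x \<ge> 0 \<Longrightarrow> (1 + 2 * a * x) powr (\<bar>p\<bar> + 1) \<le> C * exp (x / 2)"
    using affine_powr_le_exp_half[OF a, of "\<bar>p\<bar> + 1"] abs_ge_zero[of p] by (auto simp del: abs_ge_zero)
  show ?thesis
  proof (rule Bochner_Integration.integrable_bound[OF integrable_mult_right[OF integrable_powr_exp_half[OF s]]])
    show "AE x in lborel. norm (indicator {0<..} x * x powr (s - 1) * exp (- x) * (1 + 2 * a * x) powr p)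
        \<le> norm (C * (indicator {0<..} x * x powr (s - 1) * exp (- (x / 2))))"
    proof (rule AE_I2)
      fix x :: real
      show "norm (indicator {0<..} x * x powr (s - 1) * exp (- x) * (1 + 2 * a * x) powr p)
        \<le> norm (C * (indicator {0<..} x * x powr (s - 1) * exp (- (x / 2))))"
      proof (cases "x > 0")
        case True
        have "(1 + 2 * a * x) powr p \<le> (1 + 2 * a * x) powr (\<bar>p\<bar> + 1)"
          using True a by (intro powr_mono) auto
        also have "\<dots> \<le> C * exp (x / 2)" using C True by simp
        finally have "x powr (s - 1) * exp (- x) * (1 + 2 * a * x) powr p
            \<le> x powr (s - 1) * exp (- x) * (C * exp (x / 2))"
          by (intro mult_left_mono) auto
        also have "\<dots> = C * (x powr (s - 1) * exp (- (x / 2)))"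
          by (simp add: mult_ac flip: exp_add)
        finally show ?thesis using True C by (simp add: abs_mult mult_ac)
      qed simp
    qed
  qed measurable
qed

lemma gamma_mix_pos:
  assumes s: "s > 0" and a: "a > 0"
  shows "gamma_mix s p a > 0"
proof -
  have "gamma_mix s p a \<ge> 0"
    unfolding gamma_mix_def by (intro integral_nonneg_AE AE_I2) auto
  moreover have "gamma_mix s p a \<noteq> 0"
  proof
    assume "gamma_mix s p a = 0"
    then have "AE x in lborel. indicator {0<..} x * x powr (s - 1) * exp (- x) * (1 + 2 * a * x) powr p = 0"
      unfolding gamma_mix_def
      by (subst (asm) integral_nonneg_eq_0_iff_AE[OF integrable_gamma_mix[OF s a]]) auto
    moreover have "1 + 2 * a * x \<noteq> 0" if "x > 0" for x
      using a that by (metis add_pos_pos less_numeral_extra(1) less_numeral_extra(3) mult_pos_pos zero_less_numeral)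
    ultimately have "AE x in lborel. x \<notin> {0<..<1::real}"
      by (auto elim!: eventually_mono)
    then have "emeasure lborel {0<..<1::real} = 0"
      by (intro AE_iff_measurable[THEN iffD1, of "{0<..<1::real}" lborel "\<lambda>x. x \<notin> {0<..<1}"]) auto
    then show False by (subst (asm) emeasure_lborel_Ioo) auto
  qed
  ultimately show ?thesis by simp
qed

lemma gamma_integral:
  fixes s :: real
  assumes s: "s > 0"
  shows "integrable lborel (\<lambda>x::real. indicator {0<..} x * x powr (s - 1) * exp (- x))"
    and "(\<integral>x. indicator {0<..} x * x powr (s - 1) * exp (- x) \<partial>lborel) = Gamma s"
proof -
  have "(\<lambda>x::real. indicator {0<..} x * x powr (s - 1) * exp (- x) * (1 + 2 * 1 * x) powr 0)
      = (\<lambda>x. indicator {0<..} x * x powr (s - 1) * exp (- x))"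
  proof
    fix x :: real
    show "indicator {0<..} x * x powr (s - 1) * exp (- x) * (1 + 2 * 1 * x) powr 0
        = indicator {0<..} x * x powr (s - 1) * exp (- x)"
      by (cases "x > 0") auto
  qed
  with integrable_gamma_mix[OF s, of 1 0]
  show "integrable lborel (\<lambda>x::real. indicator {0<..} x * x powr (s - 1) * exp (- x))"
    by (simp only: zero_less_one simp_thms True_implies_equals)
  have "(\<integral>x. indicator {0<..} x * x powr (s - 1) * exp (- x) \<partial>lborel)
      = enn2real (\<integral>\<^sup>+x. ennreal (indicator {0<..} x * x powr (s - 1) * exp (- x)) \<partial>lborel)"
    by (intro integral_eq_nn_integral) auto
  also have "(\<integral>\<^sup>+x. ennreal (indicator {0<..} x * x powr (s - 1) * exp (- x)) \<partial>lborel)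
      = (\<integral>\<^sup>+x. ennreal (indicator {0..} x * x powr (s - 1) / exp x) \<partial>lborel)"
    by (intro nn_integral_cong arg_cong[where f = ennreal])
       (auto simp: indicator_def exp_minus field_simps)
  also have "\<dots> = Gamma s" by (rule Gamma_conv_nn_integral_real[OF s, symmetric])
  finally show "(\<integral>x. indicator {0<..} x * x powr (s - 1) * exp (- x) \<partial>lborel) = Gamma s"
    using Gamma_real_pos[OF s] by simp
qed

text \<open>Substitution w = x / z; the Jacobian and the power of w combine to z^(- s). The cut-off
  becomes z * N, so the product form on the boundary is exact only in the limit of large N.\<close>

lemma laplace_mix_scale:
  assumes z: "z > 0" and \<tau>: "\<tau> \<ge> 0"
  shows "laplace_mix p s N z \<tau> = z powr (- s) *
    (\<integral>x. indicator {0<..z * N} x * x powr (s - 1) * exp (- x) * (1 + 2 * (\<tau> / z) * x) powr p \<partial>lborel)"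
proof -
  have "laplace_mix p s N z \<tau>
      = (\<integral>w. indicator {0<..N} w * w powr (s - 1) * ((1 + 2 * \<tau> * w) powr p * exp (- (w * z))) \<partial>lborel)"
    unfolding laplace_mix_def by (rule integral_power_measure) measurable
  also have "\<dots> = \<bar>1 / z\<bar> *\<^sub>R (\<integral>x. indicator {0<..N} (0 + 1 / z * x) * (0 + 1 / z * x) powr (s - 1)
      * ((1 + 2 * \<tau> * (0 + 1 / z * x)) powr p * exp (- ((0 + 1 / z * x) * z))) \<partial>lborel)"
    using z by (intro lborel_integral_real_affine) auto
  also have "(\<integral>x. indicator {0<..N} (0 + 1 / z * x) * (0 + 1 / z * x) powr (s - 1)
      * ((1 + 2 * \<tau> * (0 + 1 / z * x)) powr p * exp (- ((0 + 1 / z * x) * z))) \<partial>lborel)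
    = (\<integral>x. z powr (1 - s) * (indicator {0<..z * N} x * x powr (s - 1) * exp (- x) * (1 + 2 * (\<tau> / z) * x) powr p) \<partial>lborel)"
  proof (intro Bochner_Integration.integral_cong refl)
    fix x :: real
    have "indicator {0<..N} (x / z) = (indicator {0<..z * N} x :: real)"
      using z by (auto simp: indicator_def field_simps)
    moreover have "(x / z) powr (s - 1) = z powr (1 - s) * x powr (s - 1)" if "x > 0"
      using that z by (simp add: powr_divide powr_diff field_simps)
    ultimately show "indicator {0<..N} (0 + 1 / z * x) * (0 + 1 / z * x) powr (s - 1)
      * ((1 + 2 * \<tau> * (0 + 1 / z * x)) powr p * exp (- ((0 + 1 / z * x) * z)))
      = z powr (1 - s) * (indicator {0<..z * N} x * x powr (s - 1) * exp (- x) * (1 + 2 * (\<tau> / z) * x) powr p)"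
      using z by (cases "x > 0") (auto simp: indicator_def)
  qed
  finally have *: "laplace_mix p s N z \<tau> = \<bar>1 / z\<bar> *\<^sub>R (\<integral>x. z powr (1 - s) *
      (indicator {0<..z * N} x * x powr (s - 1) * exp (- x) * (1 + 2 * (\<tau> / z) * x) powr p) \<partial>lborel)" .
  have "\<bar>1 / z\<bar> * z powr (1 - s) = z powr (- s)"
    using z by (simp add: powr_diff powr_minus field_simps)
  then show ?thesis
    unfolding * real_scaleR_def integral_mult_right_zero by (simp only: mult.assoc[symmetric, of "\<bar>1 / z\<bar>"])
qed

text \<open>A bound uniform in N, used to dominate the limit in N; its factor z^(- s) also forces
  decay along paths that never hit. The exponent |p| makes the integrand monotone in the ratio even
  when p is negative.\<close>

lemma laplace_mix_le_gamma_mix: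
  assumes s: "s > 0" and z: "z > 0" and \<tau>: "\<tau> \<ge> 0" "\<tau> / z \<le> a" and a: "a > 0"
  shows "laplace_mix p s N z \<tau> \<le> z powr (- s) * gamma_mix s \<bar>p\<bar> a"
  unfolding laplace_mix_scale[OF z \<tau>(1)] gamma_mix_def
proof (intro mult_left_mono integral_mono_AE' integrable_gamma_mix s a AE_I2)
  fix x :: real
  show "indicator {0<..z * N} x * x powr (s - 1) * exp (- x) * (1 + 2 * (\<tau> / z) * x) powr p
      \<le> indicator {0<..} x * x powr (s - 1) * exp (- x) * (1 + 2 * a * x) powr \<bar>p\<bar>"
  proof (cases "0 < x \<and> x \<le> z * N")
    case True
    have "(\<tau> / z) * x \<le> a * x" "0 \<le> (\<tau> / z) * x" using True \<tau> z by (auto intro!: mult_right_mono simp del: times_divide_eq_left)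
    then have "(1 + 2 * (\<tau> / z) * x) powr p \<le> (1 + 2 * a * x) powr \<bar>p\<bar>"
      by (intro powr_between) (auto simp: mult.assoc simp del: times_divide_eq_left)
    then show ?thesis using True by (auto intro!: mult_left_mono simp: indicator_def)
  qed (auto simp: indicator_def)
qed auto

lemma laplace_mix_tendsto_gamma_mix:
  assumes s: "s > 0" and z: "z > 0" and \<tau>: "\<tau> > 0"
  shows "(\<lambda>n. laplace_mix p s (real (Suc n)) z \<tau>) \<longlonglongrightarrow> z powr (- s) * gamma_mix s p (\<tau> / z)"
  unfolding laplace_mix_scale[OF z less_imp_le[OF \<tau>]] gamma_mix_def
proof (intro tendsto_mult tendsto_const integral_dominated_convergence[OF _ _ integrable_gamma_mix[OF s]])
  show "\<tau> / z > 0" using z \<tau> by simp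
  show "AE x in lborel. (\<lambda>n. indicator {0<..z * real (Suc n)} x * x powr (s - 1) * exp (- x) * (1 + 2 * (\<tau> / z) * x) powr p)
      \<longlonglongrightarrow> indicator {0<..} x * x powr (s - 1) * exp (- x) * (1 + 2 * (\<tau> / z) * x) powr p"
  proof (intro AE_I2 tendsto_mult tendsto_const)
    fix x :: real
    have "eventually (\<lambda>n. x / z \<le> real n) sequentially" by real_asymp
    then have "eventually (\<lambda>n. indicator {0<..z * real (Suc n)} x = (indicator {0<..} x :: real)) sequentially"
    proof eventually_elim
      case (elim n)
      then have "x \<le> z * real n" using z by (simp add: field_simps)
      also have "\<dots> \<le> z * real (Suc n)" using z by simp
      finally show ?case by (simp add: indicator_def)
    qed
    then show "(\<lambda>n. indicator {0<..z * real (Suc n)} x) \<longlonglongrightarrow> (indicator {0<..} x :: real)"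
      by (rule tendsto_eventually)
  qed
  show "AE x in lborel. norm (indicator {0<..z * real (Suc n)} x * x powr (s - 1) * exp (- x) * (1 + 2 * (\<tau> / z) * x) powr p)
      \<le> indicator {0<..} x * x powr (s - 1) * exp (- x) * (1 + 2 * (\<tau> / z) * x) powr p" for n
    by (auto simp: indicator_def)
qed measurable

text \<open>The gamma law concentrates at 0 as s decreases to 0. Quantitatively, the expectation
  minus 1 is \<open>rGamma s\<close> times an integral in which (1 + 2 a x)^(\<nu> - s) - 1 is of
  order x near 0 and so cancels the singularity of x^(s-1). That integral is bounded uniformly in
  small s, while \<open>rGamma s\<close> tends to 0.\<close>

lemma gamma_law_affine_powr_tendsto:
  assumes \<nu>: "\<nu> > 0" and a: "a > 0"
  shows "((\<lambda>s. \<integral>x. (1 + 2 * a * x) powr (- s + \<nu>) \<partial>gamma_law s) \<longlongrightarrow> 1) (at_right 0)"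
proof -
  obtain C where C: "C > 0" "\<And>x. x \<ge> 0 \<Longrightarrow> (1 + 2 * a * x) powr \<nu> \<le> C * exp (x / 2)"
    using affine_powr_le_exp_half[OF a \<nu>] by blast
  \<comment> \<open>The integral of (1 + x) exp(- x / 2) over x > 0, written in the shape for which
    integrability is already known.\<close>
  define D :: real where "D = (\<integral>x. indicator {0<..} x * x powr (1 - 1) * exp (- (x / 2)) \<partial>lborel)
    + (\<integral>x. indicator {0<..} x * x powr (2 - 1) * exp (- (x / 2)) \<partial>lborel)"
  define B where "B = 2 * a * \<nu> * C * D"
  have main: "\<bar>(\<integral>x. (1 + 2 * a * x) powr (- s + \<nu>) \<partial>gamma_law s) - 1\<bar> \<le> rGamma s * B"
    if s: "0 < s" "s < 1" "s < \<nu>" for s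
  proof -
    define h where "h x = indicator {0<..} x * x powr (s - 1) * exp (- x)" for x :: real
    define k where "k x = 2 * a * \<nu> * C * (indicator {0<..} x * x powr (1 - 1) * exp (- (x / 2))
      + indicator {0<..} x * x powr (2 - 1) * exp (- (x / 2)))" for x :: real
    have rG: "rGamma s > 0"
      using Gamma_real_pos[OF s(1)] by (simp add: rGamma_inverse_Gamma)
    have h1: "integrable lborel (\<lambda>x. h x * (1 + 2 * a * x) powr (- s + \<nu>))"
      using integrable_gamma_mix[OF s(1) a] by (simp add: h_def)
    have h0: "integrable lborel h" "(\<integral>x. h x \<partial>lborel) = Gamma s"
      using gamma_integral[OF s(1)] by (simp_all add: h_def[abs_def])
    have k: "integrable lborel k" "(\<integral>x. k x \<partial>lborel) = B"
      using integrable_powr_exp_half[of 1] integrable_powr_exp_half[of 2]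
      unfolding k_def B_def D_def by simp_all
    have pw: "\<bar>h x * (1 + 2 * a * x) powr (- s + \<nu>) - h x\<bar> \<le> k x" for x
    proof (cases "x > 0")
      case True
      define y where "y = 2 * a * x"
      have y: "y > 0" using a True by (simp add: y_def)
      define L where "L = ln (1 + y)"
      have L: "0 \<le> L" "L \<le> y" using y ln_add_one_self_le_self[of y] by (auto simp: L_def)
      have "1 \<le> (1 + y) powr (- s + \<nu>)" using y s by (intro ge_one_powr_ge_zero) auto
      moreover have "(1 + y) powr (- s + \<nu>) \<le> (1 + y) powr \<nu>"
        using y s by (intro powr_mono) auto
      moreover have "(1 + y) powr \<nu> - 1 \<le> \<nu> * L * (1 + y) powr \<nu>"
      proof -
        \<comment> \<open>Multiplying 1 - u \<le> exp(- u) by exp u gives exp u - 1 \<le> u exp u.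
          With u = \<nu> L and L \<le> y this produces the factor x that is wanted.\<close>
        have "1 - \<nu> * L \<le> exp (- (\<nu> * L))" using exp_ge_add_one_self[of "- (\<nu> * L)"] by simp
        then have "(1 - \<nu> * L) * exp (\<nu> * L) \<le> exp (- (\<nu> * L)) * exp (\<nu> * L)"
          by (intro mult_right_mono) auto
        then have "exp (\<nu> * L) - 1 \<le> \<nu> * L * exp (\<nu> * L)"
          by (simp add: left_diff_distrib flip: exp_add)
        then show ?thesis using y by (simp add: powr_def L_def)
      qed
      moreover have "\<nu> * L * (1 + y) powr \<nu> \<le> \<nu> * y * (C * exp (x / 2))"
        using L \<nu> C(2)[of x] True y by (intro mult_mono) (auto simp: y_def)
      ultimately have 1: "\<bar>(1 + y) powr (- s + \<nu>) - 1\<bar> \<le> \<nu> * y * (C * exp (x / 2))"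
        by linarith
      \<comment> \<open>Removes the last dependence on s, so that \<open>k\<close> dominates for all
        s in (0, 1).\<close>
      have "x powr s \<le> 1 + x"
      proof (cases "x \<le> 1")
        case True
        then have "x powr s \<le> 1" using \<open>x > 0\<close> s by (intro powr_le1) auto
        then show ?thesis using \<open>x > 0\<close> by simp
      next
        case False
        then have "x powr s \<le> x powr 1" using s by (intro powr_mono) auto
        then show ?thesis using \<open>x > 0\<close> by simp
      qed
      have "\<bar>h x * (1 + y) powr (- s + \<nu>) - h x\<bar> = h x * \<bar>(1 + y) powr (- s + \<nu>) - 1\<bar>"
      proof -
        have "h x * (1 + y) powr (- s + \<nu>) - h x = h x * ((1 + y) powr (- s + \<nu>) - 1)"
          by (simp add: right_diff_distrib)
        then show ?thesis by (simp only: abs_mult) (simp add: h_def)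
      qed
      also have "\<dots> \<le> h x * (\<nu> * y * (C * exp (x / 2)))"
        using 1 by (intro mult_left_mono) (auto simp: h_def)
      also have "\<dots> = 2 * a * \<nu> * C * (x powr s * exp (- (x / 2)))"
        using True by (simp add: h_def y_def powr_diff mult_ac exp_minus field_simps flip: exp_add)
      also have "\<dots> \<le> 2 * a * \<nu> * C * ((1 + x) * exp (- (x / 2)))"
        using \<open>x powr s \<le> 1 + x\<close> a \<nu> C by (intro mult_left_mono mult_right_mono) auto
      also have "\<dots> = k x" using True by (simp add: k_def distrib_right)
      finally show ?thesis by (simp add: y_def)
    qed (simp add: h_def k_def)
    have gl: "(\<integral>x. (1 + 2 * a * x) powr (- s + \<nu>) \<partial>gamma_law s)
        = rGamma s * (\<integral>x. h x * (1 + 2 * a * x) powr (- s + \<nu>) \<partial>lborel)"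
      unfolding h_def by (rule gamma_law_integral[OF s(1)]) measurable
    have one: "rGamma s * (\<integral>x. h x \<partial>lborel) = 1"
      unfolding h0(2) using Gamma_real_pos[OF s(1)] by (simp add: rGamma_inverse_Gamma)
    have "(\<integral>x. (1 + 2 * a * x) powr (- s + \<nu>) \<partial>gamma_law s) - 1
        = rGamma s * (\<integral>x. (h x * (1 + 2 * a * x) powr (- s + \<nu>) - h x) \<partial>lborel)"
      unfolding Bochner_Integration.integral_diff[OF h1 h0(1)] right_diff_distrib gl one ..
    then have "\<bar>(\<integral>x. (1 + 2 * a * x) powr (- s + \<nu>) \<partial>gamma_law s) - 1\<bar>
        = rGamma s * \<bar>\<integral>x. (h x * (1 + 2 * a * x) powr (- s + \<nu>) - h x) \<partial>lborel\<bar>"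
      using rG by (simp only: abs_mult abs_of_pos)
    also have "\<dots> \<le> rGamma s * (\<integral>x. k x \<partial>lborel)"
    proof (intro mult_left_mono order_trans[OF integral_abs_bound] integral_mono)
      show "integrable lborel (\<lambda>x. \<bar>h x * (1 + 2 * a * x) powr (- s + \<nu>) - h x\<bar>)"
        using h0(1) h1 by simp
    qed (use k pw rG in auto)
    finally show ?thesis by (simp add: k)
  qed
  have "((\<lambda>s. rGamma s * B) \<longlongrightarrow> rGamma 0 * B) (at_right (0::real))"
    by (intro tendsto_mult tendsto_const
        tendsto_within_subset[OF isContD[OF isCont_rGamma[OF continuous_ident]] subset_UNIV])
  then have lim: "((\<lambda>s. rGamma s * B) \<longlongrightarrow> 0) (at_right (0::real))" by simp
  have "eventually (\<lambda>s. 0 < s \<and> s < min 1 \<nu>) (at_right 0)"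
    using \<nu> by (intro eventually_at_rightI[of _ "min 1 \<nu>"]) auto
  then have "eventually (\<lambda>s. norm ((\<integral>x. (1 + 2 * a * x) powr (- s + \<nu>) \<partial>gamma_law s) - 1) \<le> rGamma s * B) (at_right 0)"
    by eventually_elim (use main in auto)
  from Lim_null_comparison[OF this lim] show ?thesis
    by (simp add: LIM_zero_iff)
qed

section \<open>Short-time behaviour of the transition function\<close>

text \<open>True for every \<open>h\<close>, since the Bochner integral of a function that is not
  integrable is 0 by convention.\<close>

lemma abs_set_integral_le:
  fixes h :: "real \<Rightarrow> real"
  assumes "t \<ge> 0" and h: "\<And>s. 0 \<le> s \<Longrightarrow> s \<le> t \<Longrightarrow> \<bar>h s\<bar> \<le> K"
  shows "\<bar>LINT s:{0..t}|lborel. h s\<bar> \<le> K * t"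
proof -
  have K: "K \<ge> 0" using h[of 0] assms(1) by auto
  have "\<bar>LINT s:{0..t}|lborel. h s\<bar> \<le> (\<integral>s. \<bar>indicator {0..t} s *\<^sub>R h s\<bar> \<partial>lborel)"
    unfolding set_lebesgue_integral_def by (rule integral_abs_bound)
  also have "\<dots> \<le> (\<integral>s. indicator {0..t} s * K \<partial>lborel)"
    by (rule integral_mono_AE')
       (use h K in \<open>auto split: split_indicator intro!: integrable_mult_left integrable_real_indicator simp: emeasure_lborel_Icc_eq\<close>)
  also have "\<dots> = K * t" using assms(1) by simp
  finally show ?thesis .
qed

section \<open>Consequences of the generator identity for the transition kernel\<close>

locale bessel_kernel =
  fixes \<nu> :: real and P :: "real \<Rightarrow> real \<Rightarrow> real measure"
  assumes \<nu>_pos: "\<nu> > 0"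
    and transition: "transition_function P"
    and generator: "has_bessel_generator \<nu> P"
begin

lemma kernel_measurable: "(\<lambda>(t, x). P t x) \<in> half_line \<Otimes>\<^sub>M half_line \<rightarrow>\<^sub>M subprob_algebra half_line"
  using transition by (intro measurable_prob_algebraD) (simp add: transition_function_def)

lemma kernel_measurable_time: "x \<ge> 0 \<Longrightarrow> (\<lambda>t. P t x) \<in> half_line \<rightarrow>\<^sub>M subprob_algebra half_line"
  using measurable_compose[OF measurable_Pair2'[of x half_line half_line] kernel_measurable] by simp

lemma kernel_measurable_space: "t \<ge> 0 \<Longrightarrow> P t \<in> half_line \<rightarrow>\<^sub>M subprob_algebra half_line"
  using measurable_compose[OF measurable_Pair1'[of t half_line half_line] kernel_measurable] by simp

lemma
  assumes "t \<ge> 0" "x \<ge> 0"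
  shows prob_space_kernel: "prob_space (P t x)"
    and sets_kernel: "sets (P t x) = sets half_line"
proof -
  have "(\<lambda>(t, x). P t x) \<in> half_line \<Otimes>\<^sub>M half_line \<rightarrow>\<^sub>M prob_algebra half_line"
    using transition by (simp add: transition_function_def)
  from measurable_space[OF this, of "(t, x)"] assms
  have "P t x \<in> space (prob_algebra half_line)" by (simp add: space_pair_measure)
  then show "prob_space (P t x)" "sets (P t x) = sets half_line"
    by (auto simp: space_prob_algebra)
qed

lemma borel_measurable_kernel:
  "t \<ge> 0 \<Longrightarrow> x \<ge> 0 \<Longrightarrow> f \<in> borel_measurable borel \<Longrightarrow> f \<in> borel_measurable (P t x)"
  using measurable_cong_sets[OF sets_kernel refl] measurable_restrict_space1 by blast

text \<open>The constant test function 1 is annihilated by the generator, so the mass of the open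
  half line remains 1.\<close>

lemma AE_kernel_pos:
  assumes "t \<ge> 0" "x > 0"
  shows "AE y in P t x. y > 0"
proof -
  interpret prob_space "P t x" using assms by (intro prob_space_kernel) auto
  have 1: "(\<lambda>_. 1) \<in> Cb2" "bessel_operator \<nu> (\<lambda>_. 1) = (\<lambda>_. 0)"
    by (auto simp: Cb2_def bessel_operator_def bounded_iff)
  have "(LINT y:{0<..}|P t x. 1) = (1::real) + (LINT s:{0..t}|lborel. (LINT y:{0<..}|P s x. bessel_operator \<nu> (\<lambda>_. 1) y))"
    using generator assms 1(1) unfolding has_bessel_generator_def by blast
  then have "(LINT y:{0<..}|P t x. 1) = (1::real)"
    unfolding 1(2) by (simp add: set_lebesgue_integral_def)
  moreover have "{0<..} \<in> sets (P t x)"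
    using assms by (subst sets_kernel) (auto simp: sets_restrict_space image_iff intro!: exI[of _ "{0<..}"] bexI[of _ "{0<..}"])
  ultimately have "prob {0<..} = 1"
    by (simp add: set_lebesgue_integral_def)
  then show ?thesis using prob_eq_1[OF \<open>{0<..} \<in> sets (P t x)\<close>] by simp
qed

lemma kernel_positive_integral:
  fixes f :: "real \<Rightarrow> real"
  assumes "t \<ge> 0" "x > 0" and f: "f \<in> borel_measurable borel"
  shows "(LINT y:{0<..}|P t x. f y) = (\<integral>y. f y \<partial>P t x)"
  unfolding set_lebesgue_integral_def
  by (rule integral_cong_AE)
     (use assms AE_kernel_pos[OF assms(1,2)] in \<open>auto intro!: borel_measurable_kernel elim!: eventually_mono\<close>)

lemma generator_formula:
  fixes f :: "real \<Rightarrow> real"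
  assumes "t \<ge> 0" "x > 0" "f \<in> borel_measurable borel" "f \<in> Cb2"
  shows "(\<integral>y. f y \<partial>P t x) = f x + (LINT s:{0..t}|lborel. (LINT y:{0<..}|P s x. bessel_operator \<nu> f y))"
proof -
  have "(LINT y:{0<..}|P t x. f y)
      = f x + (LINT s:{0..t}|lborel. (LINT y:{0<..}|P s x. bessel_operator \<nu> f y))"
    using generator assms unfolding has_bessel_generator_def by blast
  then show ?thesis unfolding kernel_positive_integral[OF assms(1-3)] .
qed

text \<open>First-order estimate, to be applied to \<open>gaussian_drift\<close> rather than to the
  Gaussian itself.\<close>

lemma kernel_increment_bound:
  fixes f :: "real \<Rightarrow> real"
  assumes t: "t \<ge> 0" and x: "x > 0" and f: "f \<in> borel_measurable borel" "f \<in> Cb2"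
    and K: "\<And>y. y > 0 \<Longrightarrow> \<bar>bessel_operator \<nu> f y\<bar> \<le> K"
  shows "\<bar>(\<integral>y. f y \<partial>P t x) - f x\<bar> \<le> K * t"
proof -
  have K0: "K \<ge> 0" using K[of 1] by simp
  have "\<bar>LINT y:{0<..}|P s x. bessel_operator \<nu> f y\<bar> \<le> K" if s: "s \<ge> 0" for s
  proof -
    interpret prob_space "P s x" using s x by (intro prob_space_kernel) auto
    have "\<bar>LINT y:{0<..}|P s x. bessel_operator \<nu> f y\<bar>
        \<le> (\<integral>y. \<bar>indicator {0<..} y *\<^sub>R bessel_operator \<nu> f y\<bar> \<partial>P s x)"
      unfolding set_lebesgue_integral_def by (rule integral_abs_bound)
    also have "\<dots> \<le> (\<integral>y. K \<partial>P s x)"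
      by (rule integral_mono_AE') (use K K0 in \<open>auto split: split_indicator\<close>)
    finally show ?thesis by (simp add: prob_space)
  qed
  then show ?thesis
    unfolding generator_formula[OF t x f] using abs_set_integral_le[OF t] by simp
qed

lemma gaussian_drift_borel [measurable]: "gaussian_drift \<nu> w \<in> borel_measurable borel"
  unfolding gaussian_drift_def by measurable

text \<open>The generator identity for f = exp(- w y^2) expresses the increment as the time integral
  of the kernel acting on the drift. The same identity for the drift shows that this integrand
  differs from its initial value by at most a constant times t, and integrating once more makes the
  error quadratic.\<close>

lemma kernel_gaussian_expansion:
  assumes t: "t \<ge> 0" and x: "x > 0" and w: "w > 0"
  shows "\<bar>(\<integral>y. exp (- (w * y\<^sup>2)) \<partial>P t x) - exp (- (w * x\<^sup>2)) - t * gaussian_drift \<nu> w x\<bar>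
       \<le> drift_bound \<nu> * w\<^sup>2 * t\<^sup>2"
proof -
  define h where "h s = (\<integral>y. gaussian_drift \<nu> w y \<partial>P s x)" for s
  define d where "d = gaussian_drift \<nu> w x"
  have C: "drift_bound \<nu> * w\<^sup>2 \<ge> 0" using \<nu>_pos by (simp add: drift_bound_def)
  have h: "\<bar>h s - d\<bar> \<le> drift_bound \<nu> * w\<^sup>2 * t" if "0 \<le> s" "s \<le> t" for s
  proof -
    have "\<bar>h s - d\<bar> \<le> drift_bound \<nu> * w\<^sup>2 * s"
      unfolding h_def d_def using that x w \<nu>_pos
      by (intro kernel_increment_bound gaussian_drift_Cb2 gaussian_drift_borel)
    also have "\<dots> \<le> drift_bound \<nu> * w\<^sup>2 * t"
      using C that by (intro mult_left_mono)
    finally show ?thesis .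
  qed
  have inner: "(LINT y:{0<..}|P s x. bessel_operator \<nu> (\<lambda>y. exp (- (w * y\<^sup>2))) y) = h s" if "s \<ge> 0" for s
  proof -
    have "(LINT y:{0<..}|P s x. bessel_operator \<nu> (\<lambda>y. exp (- (w * y\<^sup>2))) y)
        = (LINT y:{0<..}|P s x. gaussian_drift \<nu> w y)"
      unfolding set_lebesgue_integral_def
      by (intro Bochner_Integration.integral_cong) (auto simp: gaussian_Cb2(2)[OF w] split: split_indicator)
    also have "\<dots> = h s"
      unfolding h_def using that x by (intro kernel_positive_integral) auto
    finally show ?thesis .
  qed
  have "(\<integral>y. exp (- (w * y\<^sup>2)) \<partial>P t x) = exp (- (w * x\<^sup>2))
      + (LINT s:{0..t}|lborel. (LINT y:{0<..}|P s x. bessel_operator \<nu> (\<lambda>y. exp (- (w * y\<^sup>2))) y))"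
    by (rule generator_formula[OF t x _ gaussian_Cb2(1)[OF w]]) measurable
  also have "(LINT s:{0..t}|lborel. (LINT y:{0<..}|P s x. bessel_operator \<nu> (\<lambda>y. exp (- (w * y\<^sup>2))) y))
      = (LINT s:{0..t}|lborel. h s)"
    by (intro set_lebesgue_integral_cong) (auto simp: inner)
  finally have 1: "(\<integral>y. exp (- (w * y\<^sup>2)) \<partial>P t x) - exp (- (w * x\<^sup>2)) = (LINT s:{0..t}|lborel. h s)"
    by simp
  \<comment> \<open>Measurability of \<open>h\<close> in time comes from joint measurability of the
    kernel. Negative times are outside its control, hence the passage through the indicator of
    {0..}.\<close>
  have "gaussian_drift \<nu> w \<in> borel_measurable half_line"
    by (rule measurable_restrict_space1) measurable
  from measurable_compose[OF kernel_measurable_time integral_measurable_subprob_algebra[OF this], of x] x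
  have "h \<in> borel_measurable half_line" unfolding h_def by simp
  then have "(\<lambda>s. indicator {0..} s *\<^sub>R h s) \<in> borel_measurable borel"
    by (subst (asm) borel_measurable_restrict_space_iff) auto
  then have "(\<lambda>s. indicator {0..t} s *\<^sub>R (indicator {0..} s *\<^sub>R h s)) \<in> borel_measurable borel"
    by measurable
  then have hm: "(\<lambda>s. indicator {0..t} s *\<^sub>R h s) \<in> borel_measurable borel"
    by (rule measurable_cong[THEN iffD1, rotated]) (auto split: split_indicator)
  have "set_integrable lborel {0..t} h"
    unfolding set_integrable_def
  proof (rule Bochner_Integration.integrable_bound)
    show "integrable lborel (\<lambda>s. indicator {0..t} s * (\<bar>d\<bar> + drift_bound \<nu> * w\<^sup>2 * t))"
      by (intro integrable_mult_left integrable_real_indicator) (auto simp: emeasure_lborel_Icc_eq)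
    show "AE s in lborel. norm (indicator {0..t} s *\<^sub>R h s) \<le> norm (indicator {0..t} s * (\<bar>d\<bar> + drift_bound \<nu> * w\<^sup>2 * t))"
      using h by (intro AE_I2) (fastforce split: split_indicator)
  qed (use hm in simp)
  moreover have "set_integrable lborel {0..t} (\<lambda>_. d)"
    unfolding set_integrable_def by (intro integrable_scaleR_left integrable_real_indicator) (auto simp: emeasure_lborel_Icc_eq)
  ultimately have "(LINT s:{0..t}|lborel. h s) - t * d = (LINT s:{0..t}|lborel. h s - d)"
    using t by (simp add: set_integral_diff) (simp add: set_lebesgue_integral_def)
  then have "\<bar>(LINT s:{0..t}|lborel. h s) - t * d\<bar> \<le> drift_bound \<nu> * w\<^sup>2 * t * t"
    using abs_set_integral_le[OF t h] by simp
  then show ?thesis unfolding 1 d_def by (simp add: power2_eq_square mult.assoc)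
qed

text \<open>Fubini reduces the action of the kernel on a mixture to its action on each Gaussian. On
  the product of a finite measure and a probability measure it suffices that the integrand is
  bounded.\<close>

lemma
  assumes t: "t \<ge> 0" and x: "x > 0" and s: "s > 0" and \<tau>: "\<tau> \<ge> 0"
  shows kernel_laplace_mix: "(\<integral>y. laplace_mix p s N (y\<^sup>2) \<tau> \<partial>P t x)
      = (\<integral>w. (1 + 2 * \<tau> * w) powr p * (\<integral>y. exp (- (w * y\<^sup>2)) \<partial>P t x) \<partial>power_measure s N)" (is ?eq)
    and integrable_kernel_laplace_mix:
      "integrable (power_measure s N) (\<lambda>w. (1 + 2 * \<tau> * w) powr p * (\<integral>y. exp (- (w * y\<^sup>2)) \<partial>P t x))" (is ?int)
proof -
  interpret K: prob_space "P t x" using t x by (intro prob_space_kernel) auto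
  interpret W: finite_measure "power_measure s N" using s by (rule finite_measure_power_measure)
  interpret pair_sigma_finite "power_measure s N" "P t x" ..
  define Q where "Q = (1 + 2 * \<tau> * N) powr \<bar>p\<bar>"
  have [measurable]: "(\<lambda>y. y) \<in> borel_measurable (P t x)"
    using t x by (intro borel_measurable_kernel) auto
  have meas: "(\<lambda>(w, y). (1 + 2 * \<tau> * w) powr p * exp (- (w * y\<^sup>2)))
      \<in> borel_measurable (power_measure s N \<Otimes>\<^sub>M P t x)"
    by measurable
  have Q: "\<bar>(1 + 2 * \<tau> * w) powr p * exp (- (w * y\<^sup>2))\<bar> \<le> Q" if "0 < w \<and> w \<le> N" for w y
  proof -
    have "(1 + 2 * \<tau> * w) powr p * exp (- (w * y\<^sup>2)) \<le> Q * 1"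
      unfolding Q_def using that \<tau> by (intro mult_mono powr_between) (auto intro!: mult_mono)
    then show ?thesis by simp
  qed
  have intK: "integrable (P t x) (\<lambda>y. (1 + 2 * \<tau> * w) powr p * exp (- (w * y\<^sup>2)))"
    if "0 < w \<and> w \<le> N" for w
    by (rule K.integrable_const_bound[of _ Q]) (use Q[OF that] in auto)
  have bound: "(\<integral>y. \<bar>(1 + 2 * \<tau> * w) powr p * exp (- (w * y\<^sup>2))\<bar> \<partial>P t x) \<le> Q" if "0 < w \<and> w \<le> N" for w
  proof -
    have "(\<integral>y. \<bar>(1 + 2 * \<tau> * w) powr p * exp (- (w * y\<^sup>2))\<bar> \<partial>P t x) \<le> (\<integral>y. Q \<partial>P t x)"
      by (intro integral_mono intK[THEN integrable_abs] that Q) auto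
    then show ?thesis by (simp add: K.prob_space)
  qed
  have prod: "integrable (power_measure s N \<Otimes>\<^sub>M P t x) (\<lambda>(w, y). (1 + 2 * \<tau> * w) powr p * exp (- (w * y\<^sup>2)))"
  proof (rule Fubini_integrable[OF meas])
    have m: "(\<lambda>w. \<integral>y. \<bar>(1 + 2 * \<tau> * w) powr p * exp (- (w * y\<^sup>2))\<bar> \<partial>P t x) \<in> borel_measurable (power_measure s N)"
      by measurable
    have nQ: "norm (\<integral>y. \<bar>(1 + 2 * \<tau> * w) powr p * exp (- (w * y\<^sup>2))\<bar> \<partial>P t x) \<le> Q"
      if "0 < w \<and> w \<le> N" for w
      using bound[OF that] by (subst real_norm_def, subst abs_of_nonneg) (auto intro!: integral_nonneg_AE)
    show "integrable (power_measure s N)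
        (\<lambda>w. \<integral>y. norm (case (w, y) of (w, y) \<Rightarrow> (1 + 2 * \<tau> * w) powr p * exp (- (w * y\<^sup>2))) \<partial>P t x)"
      unfolding prod.case real_norm_def
      by (rule W.integrable_const_bound[OF eventually_mono[OF AE_power_measure nQ] m])
    show "AE w in power_measure s N. integrable (P t x)
        (\<lambda>y. case (w, y) of (w, y) \<Rightarrow> (1 + 2 * \<tau> * w) powr p * exp (- (w * y\<^sup>2)))"
      unfolding prod.case by (rule eventually_mono[OF AE_power_measure intK])
  qed
  show ?eq using Fubini_integral[OF prod] by (simp add: laplace_mix_def)
  show ?int using integrable_fst'[OF prod] by simp
qed

text \<open>The first summand stems from the Gaussian expansion in space, the second from the Taylor
  expansion in time. The value does not depend on the starting point or the step length, so it is a
  mere constant while the mesh shrinks.\<close>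

definition step_error :: "real \<Rightarrow> real \<Rightarrow> real \<Rightarrow> real \<Rightarrow> real" where
  "step_error p s N U = (drift_bound \<nu> * N\<^sup>2 + 2 * N\<^sup>2 * \<bar>p * (p - 1)\<bar>) * (1 + 2 * U * N) powr \<bar>p\<bar>
     * measure (power_measure s N) UNIV"

text \<open>The integrand changes by \<delta> * D + E. The integral of D is the boundary term at the
  cut-off, and E collects what is of second order in \<delta>. The process moves from time argument
  \<tau> - \<delta> to \<tau>, which is why time is expanded backwards.\<close>

lemma kernel_laplace_mix_step:
  assumes s: "s > 0" and N: "N > 0" and x: "x > 0" and \<delta>: "0 \<le> \<delta>" "\<delta> \<le> \<tau>" and U: "\<tau> \<le> U"
  shows "\<bar>(\<integral>y. laplace_mix (\<nu> - s) s N (y\<^sup>2) \<tau> \<partial>P \<delta> x) - laplace_mix (\<nu> - s) s N (x\<^sup>2) (\<tau> - \<delta>)\<bar>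
    \<le> \<delta> * (2 * N powr (s + 1) * (1 + 2 * U * N) powr \<bar>\<nu> - s\<bar> * exp (- (N * x\<^sup>2)))
      + step_error (\<nu> - s) s N U * \<delta>\<^sup>2"
proof -
  define p where "p = \<nu> - s"
  define Q where "Q = (1 + 2 * U * N) powr \<bar>p\<bar>"
  define m where "m = power_measure s N"
  define V where "V w = (\<integral>y. exp (- (w * y\<^sup>2)) \<partial>P \<delta> x)" for w
  define e where "e w = exp (- (w * x\<^sup>2))" for w
  define a where "a t w = (1 + 2 * t * w) powr p" for t w
  define a' where "a' w = 2 * w * p * (1 + 2 * \<tau> * w) powr (p - 1)" for w
  define D where "D w = a \<tau> w * gaussian_drift \<nu> w x + a' w * e w" for w
  define E where "E w = a \<tau> w * V w - a (\<tau> - \<delta>) w * e w - \<delta> * D w" for w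
  have \<tau>: "\<tau> \<ge> 0" using \<delta> by simp
  have aQ: "(1 + 2 * \<tau> * w) powr q \<le> Q" if "0 < w" "w \<le> N" "q \<le> p" for w q
    unfolding Q_def using that \<tau> U by (intro powr_between) (auto intro!: mult_mono)
  have e1: "e w \<le> 1" "e w \<ge> 0" if "0 < w" for w using that by (auto simp: e_def)
  have "integrable m (\<lambda>w. a \<tau> w * gaussian_drift \<nu> w x)"
    unfolding m_def a_def
  proof (rule integrable_power_measure[OF s, where B = "Q * (2 * N\<^sup>2 * x\<^sup>2 + 2 * (\<nu> + 1) * N)"])
    fix w assume w: "0 < w" "w \<le> N"
    have "\<bar>2 * w\<^sup>2 * x\<^sup>2 - 2 * (\<nu> + 1) * w\<bar> \<le> 2 * w\<^sup>2 * x\<^sup>2 + 2 * (\<nu> + 1) * w"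
      using w \<nu>_pos by (intro abs_leI) (auto simp: algebra_simps)
    also have "\<dots> \<le> 2 * N\<^sup>2 * x\<^sup>2 + 2 * (\<nu> + 1) * N"
      using w x \<nu>_pos by (intro add_mono mult_mono power_mono) auto
    finally have 1: "\<bar>2 * w\<^sup>2 * x\<^sup>2 - 2 * (\<nu> + 1) * w\<bar> \<le> 2 * N\<^sup>2 * x\<^sup>2 + 2 * (\<nu> + 1) * N" .
    have "\<bar>gaussian_drift \<nu> w x\<bar> \<le> \<bar>2 * w\<^sup>2 * x\<^sup>2 - 2 * (\<nu> + 1) * w\<bar> * 1"
      unfolding gaussian_drift_def abs_mult using w by (intro mult_left_mono) auto
    then show "\<bar>(1 + 2 * \<tau> * w) powr p * gaussian_drift \<nu> w x\<bar> \<le> Q * (2 * N\<^sup>2 * x\<^sup>2 + 2 * (\<nu> + 1) * N)"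
      unfolding abs_mult using aQ[OF w order_refl] 1 by (intro mult_mono) (auto simp: Q_def)
  qed (unfold gaussian_drift_def, measurable)
  moreover have "integrable m (\<lambda>w. a' w * e w)"
    unfolding m_def a'_def e_def
  proof (rule integrable_power_measure[OF s, where B = "2 * N * \<bar>p\<bar> * Q * 1"])
    fix w assume w: "0 < w" "w \<le> N"
    show "\<bar>2 * w * p * (1 + 2 * \<tau> * w) powr (p - 1) * exp (- (w * x\<^sup>2))\<bar> \<le> 2 * N * \<bar>p\<bar> * Q * 1"
      unfolding abs_mult using w aQ[of w "p - 1"] by (intro mult_mono) (auto simp: Q_def)
  qed measurable
  ultimately have intD: "integrable m D"
    unfolding D_def by (rule Bochner_Integration.integrable_add)
  have intV: "integrable m (\<lambda>w. a \<tau> w * V w)"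
    unfolding m_def a_def V_def by (rule integrable_kernel_laplace_mix[OF \<delta>(1) x s \<tau>])
  have inte: "integrable m (\<lambda>w. a (\<tau> - \<delta>) w * e w)"
    unfolding m_def a_def e_def using s \<delta> by (intro integrable_laplace_mix) auto
  have "(\<integral>w. E w \<partial>m) = (\<integral>w. a \<tau> w * V w \<partial>m) - (\<integral>w. a (\<tau> - \<delta>) w * e w \<partial>m) - \<delta> * (\<integral>w. D w \<partial>m)"
    unfolding E_def using intD intV inte by simp
  then have eq: "(\<integral>y. laplace_mix p s N (y\<^sup>2) \<tau> \<partial>P \<delta> x) - laplace_mix p s N (x\<^sup>2) (\<tau> - \<delta>)
      = \<delta> * (\<integral>w. D w \<partial>m) + (\<integral>w. E w \<partial>m)"
    unfolding kernel_laplace_mix[OF \<delta>(1) x s \<tau>]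
    by (simp add: laplace_mix_def m_def a_def V_def e_def)
  have "(\<integral>w. D w \<partial>m) = - 2 * N powr (s + 1) * (1 + 2 * \<tau> * N) powr p * exp (- (N * x\<^sup>2))"
    using power_measure_drift_integral[OF s \<tau> N, of \<nu> x] intD
    unfolding D_def a_def a'_def e_def m_def p_def by simp
  then have "\<bar>\<integral>w. D w \<partial>m\<bar> = 2 * N powr (s + 1) * (1 + 2 * \<tau> * N) powr p * exp (- (N * x\<^sup>2))"
    by (simp add: abs_mult)
  also have "\<dots> \<le> 2 * N powr (s + 1) * Q * exp (- (N * x\<^sup>2))"
    using aQ[of N p] N by (intro mult_right_mono mult_left_mono) auto
  finally have 1: "\<bar>\<integral>w. D w \<partial>m\<bar> \<le> 2 * N powr (s + 1) * Q * exp (- (N * x\<^sup>2))" .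
  have "\<bar>\<integral>w. E w \<partial>m\<bar> \<le> (drift_bound \<nu> * N\<^sup>2 + 2 * N\<^sup>2 * \<bar>p * (p - 1)\<bar>) * Q * \<delta>\<^sup>2 * measure m UNIV"
    unfolding m_def
  proof (rule integral_power_measure_le[OF s])
    have dn: "drift_bound \<nu> \<ge> 0" using \<nu>_pos by (simp add: drift_bound_def)
    then show "0 \<le> (drift_bound \<nu> * N\<^sup>2 + 2 * N\<^sup>2 * \<bar>p * (p - 1)\<bar>) * Q * \<delta>\<^sup>2"
      by (simp add: Q_def)
    fix w assume w: "0 < w" "w \<le> N"
    \<comment> \<open>Splits the error into the spatial one, with the time coefficient frozen at
      \<tau>, and the temporal one, with the space variable frozen at x.\<close>
    have "E w = a \<tau> w * (V w - e w - \<delta> * gaussian_drift \<nu> w x) - (a (\<tau> - \<delta>) w - a \<tau> w + \<delta> * a' w) * e w"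
      unfolding E_def D_def by (simp add: algebra_simps)
    also have "\<bar>\<dots>\<bar> \<le> a \<tau> w * \<bar>V w - e w - \<delta> * gaussian_drift \<nu> w x\<bar> + \<bar>a (\<tau> - \<delta>) w - a \<tau> w + \<delta> * a' w\<bar> * e w"
      using e1[OF w(1)] by (intro order_trans[OF abs_triangle_ineq4]) (simp add: abs_mult a_def)
    also have "\<dots> \<le> Q * (drift_bound \<nu> * N\<^sup>2 * \<delta>\<^sup>2) + (2 * N\<^sup>2 * \<bar>p * (p - 1)\<bar> * Q * \<delta>\<^sup>2) * 1"
    proof (intro add_mono mult_mono)
      show "a \<tau> w \<le> Q" unfolding a_def using w by (intro aQ) auto
      have "\<bar>V w - e w - \<delta> * gaussian_drift \<nu> w x\<bar> \<le> drift_bound \<nu> * w\<^sup>2 * \<delta>\<^sup>2"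
        unfolding V_def e_def using \<delta> x w by (intro kernel_gaussian_expansion)
      also have "\<dots> \<le> drift_bound \<nu> * N\<^sup>2 * \<delta>\<^sup>2"
        using w dn by (intro mult_right_mono mult_left_mono power_mono) auto
      finally show "\<bar>V w - e w - \<delta> * gaussian_drift \<nu> w x\<bar> \<le> drift_bound \<nu> * N\<^sup>2 * \<delta>\<^sup>2" .
      show "\<bar>a (\<tau> - \<delta>) w - a \<tau> w + \<delta> * a' w\<bar> \<le> 2 * N\<^sup>2 * \<bar>p * (p - 1)\<bar> * Q * \<delta>\<^sup>2"
        unfolding a_def a'_def Q_def using w \<delta> U by (intro affine_powr_taylor) auto
    qed (use e1[OF w(1)] in \<open>auto simp: Q_def\<close>)
    also have "\<dots> = (drift_bound \<nu> * N\<^sup>2 + 2 * N\<^sup>2 * \<bar>p * (p - 1)\<bar>) * Q * \<delta>\<^sup>2"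
      by (simp add: algebra_simps)
    finally show "\<bar>E w\<bar> \<le> (drift_bound \<nu> * N\<^sup>2 + 2 * N\<^sup>2 * \<bar>p * (p - 1)\<bar>) * Q * \<delta>\<^sup>2" .
  qed
  also have "\<dots> = step_error p s N U * \<delta>\<^sup>2"
    by (simp add: step_error_def Q_def m_def)
  finally have 2: "\<bar>\<integral>w. E w \<partial>m\<bar> \<le> step_error p s N U * \<delta>\<^sup>2" .
  have "\<bar>\<delta> * (\<integral>w. D w \<partial>m) + (\<integral>w. E w \<partial>m)\<bar> \<le> \<delta> * \<bar>\<integral>w. D w \<partial>m\<bar> + \<bar>\<integral>w. E w \<partial>m\<bar>"
    using \<delta> by (intro order_trans[OF abs_triangle_ineq]) (simp add: abs_mult)
  also have "\<dots> \<le> \<delta> * (2 * N powr (s + 1) * Q * exp (- (N * x\<^sup>2))) + step_error p s N U * \<delta>\<^sup>2"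
    using 1 2 \<delta> by (intro add_mono mult_left_mono) auto
  finally show ?thesis unfolding eq[unfolded p_def] Q_def p_def .
qed

end

section \<open>Discretised optional stopping\<close>

text \<open>A continuous function that is positive on a compact interval has a positive minimum, so
  it exceeds some 1 / (m + 1); by continuity this need only be tested on a countable dense set. Only
  times up to t are consulted, which puts the event into the sigma-algebra at time t.\<close>

lemma sets_all_positive_until:
  fixes H :: "real \<Rightarrow> 'w \<Rightarrow> real"
  assumes t: "t \<ge> 0"
    and meas: "\<And>u. 0 \<le> u \<Longrightarrow> u \<le> t \<Longrightarrow> H u \<in> borel_measurable F"
    and cont: "\<And>\<omega>. \<omega> \<in> space F \<Longrightarrow> continuous_on {0..t} (\<lambda>u. H u \<omega>)"
  shows "{\<omega> \<in> space F. \<forall>u\<in>{0..t}. 0 < H u \<omega>} \<in> sets F"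
proof -
  \<comment> \<open>The point 0 keeps the set nonempty and makes it dense also in the degenerate
    case t = 0.\<close>
  define S where "S = insert 0 ({0<..<t} \<inter> \<rat>)"
  have S: "countable S" "S \<noteq> {}" "S \<subseteq> {0..t}"
    unfolding S_def using t by (auto intro!: countable_insert countable_Int2 countable_rat)
  have cl: "{0..t} \<subseteq> closure S"
  proof (cases "t = 0")
    case True
    then show ?thesis using closure_subset[of S] by (auto simp: S_def)
  next
    case False
    with t have "{0..t} = closure {0<..<t}" by simp
    also have "\<dots> = closure ({0<..<t} \<inter> \<rat>)"
      by (rule closure_open_Int_superset[symmetric]) (auto simp: Rats_closure_real)
    also have "\<dots> \<subseteq> closure S" by (rule closure_mono) (auto simp: S_def)
    finally show ?thesis .
  qed
  have "{\<omega> \<in> space F. \<forall>u\<in>{0..t}. 0 < H u \<omega>} = (\<Union>m. \<Inter>q\<in>S. {\<omega> \<in> space F. 1 / real (Suc m) \<le> H q \<omega>})"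
  proof (intro equalityI subsetI)
    fix \<omega> assume \<omega>: "\<omega> \<in> {\<omega> \<in> space F. \<forall>u\<in>{0..t}. 0 < H u \<omega>}"
    then have sp: "\<omega> \<in> space F" by simp
    have "\<exists>v\<in>{0..t}. \<forall>u\<in>{0..t}. H v \<omega> \<le> H u \<omega>"
      using t cont[OF sp] by (intro continuous_attains_inf) auto
    then obtain v where v: "v \<in> {0..t}" "\<And>u. u \<in> {0..t} \<Longrightarrow> H v \<omega> \<le> H u \<omega>"
      by blast
    have "H v \<omega> > 0" using \<omega> v(1) by simp
    then obtain m where m: "1 / real (Suc m) < H v \<omega>"
      by (rule nat_approx_posE)
    have "1 / real (Suc m) \<le> H q \<omega>" if "q \<in> S" for q
    proof -
      have "q \<in> {0..t}" using S(3) that by blast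
      from v(2)[OF this] m show ?thesis by simp
    qed
    then have "\<omega> \<in> (\<Inter>q\<in>S. {\<omega> \<in> space F. 1 / real (Suc m) \<le> H q \<omega>})"
      using sp by blast
    then show "\<omega> \<in> (\<Union>m. \<Inter>q\<in>S. {\<omega> \<in> space F. 1 / real (Suc m) \<le> H q \<omega>})"
      by blast
  next
    fix \<omega> assume "\<omega> \<in> (\<Union>m. \<Inter>q\<in>S. {\<omega> \<in> space F. 1 / real (Suc m) \<le> H q \<omega>})"
    then obtain m where m: "\<And>q. q \<in> S \<Longrightarrow> \<omega> \<in> space F \<and> 1 / real (Suc m) \<le> H q \<omega>"
      by auto
    then have sp: "\<omega> \<in> space F" using S by auto
    have "closure S \<subseteq> {0..t}"
      using S by (intro closure_minimal) auto
    then have cc: "continuous_on (closure S) (\<lambda>u. H u \<omega>)"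
      by (rule continuous_on_subset[OF cont[OF sp]])
    have "1 / real (Suc m) \<le> H u \<omega>" if "u \<in> {0..t}" for u
    proof (rule continuous_ge_on_closure[OF cc])
      show "u \<in> closure S" using that cl by blast
      show "1 / real (Suc m) \<le> H q \<omega>" if "q \<in> S" for q
        using m[OF that] by blast
    qed
    moreover have "1 / real (Suc m) > 0" by simp
    ultimately have "0 < H u \<omega>" if "u \<in> {0..t}" for u
      using that less_le_trans by blast
    then show "\<omega> \<in> {\<omega> \<in> space F. \<forall>u\<in>{0..t}. 0 < H u \<omega>}" using sp by simp
  qed
  also have "\<dots> \<in> sets F"
  proof (intro sets.countable_UN sets.countable_INT' image_subsetI S)
    fix m q assume "q \<in> S"
    then have [measurable]: "H q \<in> borel_measurable F"
      using S by (intro meas) auto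
    show "{\<omega> \<in> space F. 1 / real (Suc m) \<le> H q \<omega>} \<in> sets F"
      by measurable
  qed
  finally show ?thesis .
qed

text \<open>The increments that begin strictly before u telescope to the first grid point at or
  after u. The first n increments suffice because u \<le> T.\<close>

lemma sum_before_stop:
  fixes Z :: "real \<Rightarrow> real" and n :: nat
  assumes n: "n > 0" and T: "T > 0" and u: "0 \<le> u" "u \<le> T"
  shows "Z 0 + (\<Sum>k<n. (if real k * (T / n) < u then Z (real (Suc k) * (T / n)) - Z (real k * (T / n)) else 0))
    = Z (T / n * real (nat \<lceil>u / (T / n)\<rceil>))"
proof -
  define d where "d = T / n"
  have d: "d > 0" using n T by (simp add: d_def)
  define m where "m = nat \<lceil>u / d\<rceil>"
  have iff: "real k * d < u \<longleftrightarrow> k < m" for k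
  proof -
    have "real k * d < u \<longleftrightarrow> real k < u / d" using d by (simp add: field_simps)
    also have "\<dots> \<longleftrightarrow> k < m" unfolding m_def by linarith
    finally show ?thesis .
  qed
  have "u / d \<le> real n" using u n T by (simp add: d_def field_simps)
  then have "m \<le> n" unfolding m_def by linarith
  have "(\<Sum>k<n. (if real k * d < u then Z (real (Suc k) * d) - Z (real k * d) else 0))
      = (\<Sum>k\<in>{..<n} \<inter> {k. k < m}. Z (real (Suc k) * d) - Z (real k * d))"
    unfolding iff by (subst sum.inter_restrict) (auto intro!: sum.cong)
  also have "{..<n} \<inter> {k. k < m} = {..<m}" using \<open>m \<le> n\<close> by auto
  also have "(\<Sum>k<m. Z (real (Suc k) * d) - Z (real k * d)) = Z (real m * d) - Z 0"
    by (subst sum_lessThan_telescope[where f = "\<lambda>k. Z (real k * d)"]) simp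
  finally show ?thesis
    unfolding d_def[symmetric] m_def[symmetric] by (simp add: mult.commute)
qed

section \<open>The filtered process and the Markov property for integrals\<close>

locale bessel_path = bessel_kernel \<nu> P + prob_space M
  for \<nu> P and M :: "'w measure" +
  fixes R :: "real \<Rightarrow> 'w \<Rightarrow> real" and b c :: real
  assumes markov: "markov_process M P R"
    and cont: "\<And>\<omega>. \<omega> \<in> space M \<Longrightarrow> continuous_on {0..} (\<lambda>u. R u \<omega>)"
    and start: "AE \<omega> in M. R 0 \<omega> = 1"
    and b_pos: "0 < b" and b_less_c: "b < c"
begin

lemma process_measurable_half_line: "u \<ge> 0 \<Longrightarrow> R u \<in> M \<rightarrow>\<^sub>M half_line"
  using markov by (simp add: markov_process_def)

lemma process_measurable: "u \<ge> 0 \<Longrightarrow> R u \<in> borel_measurable M"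
  using process_measurable_half_line[of u] by (simp add: measurable_restrict_space2_iff)

lemma process_nonneg: "u \<ge> 0 \<Longrightarrow> \<omega> \<in> space M \<Longrightarrow> R u \<omega> \<ge> 0"
  using measurable_space[OF process_measurable_half_line, of u \<omega>] by simp

lemma space_natural_filtration [simp]: "space (natural_filtration M R t) = space M"
  by (simp add: natural_filtration_def space_measure_of_conv)

lemma sets_natural_filtration:
  "sets (natural_filtration M R t) = sigma_sets (space M)
     {R u -` A \<inter> space M | u A. 0 \<le> u \<and> u \<le> t \<and> A \<in> sets half_line}"
  unfolding natural_filtration_def by (rule sets_measure_of) auto

lemma natural_filtration_subalgebra: "subalgebra M (natural_filtration M R t)"
  unfolding subalgebra_def sets_natural_filtration
  by (auto intro!: sets.sigma_sets_subset measurable_sets[OF process_measurable_half_line])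

lemma process_adapted: "0 \<le> u \<Longrightarrow> u \<le> t \<Longrightarrow> R u \<in> borel_measurable (natural_filtration M R t)"
proof -
  assume u: "0 \<le> u" "u \<le> t"
  have "R u \<in> natural_filtration M R t \<rightarrow>\<^sub>M half_line"
    by (rule measurableI)
       (use u process_nonneg in \<open>auto simp: sets_natural_filtration intro!: sigma_sets.Basic\<close>)
  then show ?thesis by (simp add: measurable_restrict_space2_iff)
qed

text \<open>The hypothesis speaks of indicators of sets only. Weighting M by the indicator of B
  turns it into an equality of two measures, the law of R at time u + t and the law at time u
  propagated by the kernel; equal measures integrate all functions alike.\<close>

lemma markov_nn_integral:
  fixes \<phi> :: "real \<Rightarrow> ennreal"
  assumes u: "u \<ge> 0" and t: "t \<ge> 0" and B: "B \<in> sets (natural_filtration M R u)"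
    and \<phi>: "\<phi> \<in> borel_measurable borel"
  shows "(\<integral>\<^sup>+\<omega>. indicator B \<omega> * \<phi> (R (u + t) \<omega>) \<partial>M)
       = (\<integral>\<^sup>+\<omega>. indicator B \<omega> * (\<integral>\<^sup>+y. \<phi> y \<partial>P t (R u \<omega>)) \<partial>M)"
proof -
  interpret F: finite_measure_subalgebra M "natural_filtration M R u"
    by standard (rule natural_filtration_subalgebra)
  have ut: "u + t \<ge> 0" using u t by simp
  have B' [measurable]: "B \<in> sets M"
    using B natural_filtration_subalgebra[of u] by (auto simp: subalgebra_def)
  note [measurable] = process_measurable_half_line[OF u] process_measurable_half_line[OF ut]
    kernel_measurable_space[OF t]
  have \<phi>' [measurable]: "\<phi> \<in> borel_measurable half_line"
    using \<phi> by (rule measurable_restrict_space1)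
  define D where "D = density M (indicator B :: 'w \<Rightarrow> ennreal)"
  have D_sets [measurable_cong, simp]: "sets D = sets M" by (simp add: D_def)
  define \<mu> where "\<mu> = distr D half_line (R u) \<bind> P t"
  have \<mu>_sets: "sets \<mu> = sets half_line"
    unfolding \<mu>_def by (rule sets_bind) (use t sets_kernel in auto)
  have "distr D half_line (R (u + t)) = \<mu>"
  proof (rule measure_eqI)
    fix A assume "A \<in> sets (distr D half_line (R (u + t)))"
    then have A [measurable]: "A \<in> sets half_line" by simp
    have ind: "integrable M (\<lambda>\<omega>. indicator A (R (u + t) \<omega>) :: real)"
      by (rule integrable_const_bound[of _ 1]) (auto split: split_indicator)
    have [measurable]: "(\<lambda>\<omega>. measure (P t (R u \<omega>)) A) \<in> borel_measurable M"
      using measurable_compose[OF process_measurable_half_line[OF u]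
          measurable_compose[OF kernel_measurable_space[OF t] measurable_measure_subprob_algebra[OF A]]] .
    have le1: "measure (P t (R u \<omega>)) A \<le> 1" if "\<omega> \<in> space M" for \<omega>
      using prob_space_kernel[OF t process_nonneg[OF u that]] by (rule prob_space.prob_le_1)
    have "(\<integral>\<omega>. indicator B \<omega> * indicator A (R (u + t) \<omega>) \<partial>M)
        = (\<integral>\<omega>\<in>B. real_cond_exp M (natural_filtration M R u) (\<lambda>\<omega>. indicator A (R (u + t) \<omega>)) \<omega> \<partial>M)"
      using F.real_cond_exp_intA[OF ind B] by (simp add: set_lebesgue_integral_def)
    also have "\<dots> = (\<integral>\<omega>. indicator B \<omega> * measure (P t (R u \<omega>)) A \<partial>M)"
      unfolding set_lebesgue_integral_def
    proof (rule integral_cong_AE)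
      have "AE \<omega> in M. real_cond_exp M (natural_filtration M R u) (\<lambda>\<omega>. indicator A (R (u + t) \<omega>)) \<omega>
          = measure (P t (R u \<omega>)) A"
        using markov u t A unfolding markov_process_def by blast
      then show "AE \<omega> in M. indicator B \<omega> *\<^sub>R real_cond_exp M (natural_filtration M R u) (\<lambda>\<omega>. indicator A (R (u + t) \<omega>)) \<omega>
          = indicator B \<omega> * measure (P t (R u \<omega>)) A"
        by (auto elim!: eventually_mono)
    qed measurable
    finally have real_eq: "(\<integral>\<omega>. indicator B \<omega> * indicator A (R (u + t) \<omega>) \<partial>M)
        = (\<integral>\<omega>. indicator B \<omega> * measure (P t (R u \<omega>)) A \<partial>M)" .
    have "emeasure (distr D half_line (R (u + t))) A = (\<integral>\<^sup>+\<omega>. indicator B \<omega> * indicator A (R (u + t) \<omega>) \<partial>M)"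
      unfolding D_def by (simp flip: nn_integral_indicator add: nn_integral_distr nn_integral_density)
    also have "\<dots> = (\<integral>\<^sup>+\<omega>. ennreal (indicator B \<omega> * indicator A (R (u + t) \<omega>)) \<partial>M)"
      by (intro nn_integral_cong) (auto split: split_indicator)
    also have "\<dots> = ennreal (\<integral>\<omega>. indicator B \<omega> * indicator A (R (u + t) \<omega>) \<partial>M)"
      by (rule nn_integral_eq_integral)
         (auto intro!: integrable_const_bound[of _ 1] split: split_indicator)
    also have "\<dots> = (\<integral>\<^sup>+\<omega>. ennreal (indicator B \<omega> * measure (P t (R u \<omega>)) A) \<partial>M)"
      unfolding real_eq
      by (rule nn_integral_eq_integral[symmetric])
         (use le1 in \<open>auto intro!: integrable_const_bound[of _ 1] AE_I2 split: split_indicator\<close>)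
    also have "\<dots> = (\<integral>\<^sup>+\<omega>. indicator B \<omega> * emeasure (P t (R u \<omega>)) A \<partial>M)"
    proof (intro nn_integral_cong)
      fix \<omega> assume "\<omega> \<in> space M"
      then interpret K: prob_space "P t (R u \<omega>)" by (intro prob_space_kernel t process_nonneg u)
      show "ennreal (indicator B \<omega> * measure (P t (R u \<omega>)) A) = indicator B \<omega> * emeasure (P t (R u \<omega>)) A"
        by (auto simp: K.emeasure_eq_measure split: split_indicator)
    qed
    also have "\<dots> = emeasure \<mu> A"
      unfolding \<mu>_def
      by (subst emeasure_bind[where N = half_line])
         (auto simp: D_def nn_integral_distr nn_integral_density)
    finally show "emeasure (distr D half_line (R (u + t))) A = emeasure \<mu> A" .
  qed (simp add: \<mu>_sets)
  then have "(\<integral>\<^sup>+y. \<phi> y \<partial>distr D half_line (R (u + t))) = (\<integral>\<^sup>+y. \<phi> y \<partial>\<mu>)"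
    by simp
  also have "\<dots> = (\<integral>\<^sup>+x. \<integral>\<^sup>+y. \<phi> y \<partial>P t x \<partial>distr D half_line (R u))"
    unfolding \<mu>_def by (rule nn_integral_bind[where B = half_line]) simp_all
  also have "\<dots> = (\<integral>\<^sup>+\<omega>. indicator B \<omega> * (\<integral>\<^sup>+y. \<phi> y \<partial>P t (R u \<omega>)) \<partial>M)"
    unfolding D_def by (simp add: nn_integral_distr nn_integral_density)
  also have "(\<integral>\<^sup>+y. \<phi> y \<partial>distr D half_line (R (u + t))) = (\<integral>\<^sup>+\<omega>. indicator B \<omega> * \<phi> (R (u + t) \<omega>) \<partial>M)"
    unfolding D_def by (simp add: nn_integral_distr nn_integral_density)
  finally show ?thesis .
qed

lemma
  fixes \<phi> :: "real \<Rightarrow> real"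
  assumes u: "u \<ge> 0" and t: "t \<ge> 0" and \<phi>: "\<phi> \<in> borel_measurable borel"
    and bound: "\<And>y. 0 \<le> \<phi> y" "\<And>y. \<phi> y \<le> K"
  shows markov_integral: "B \<in> sets (natural_filtration M R u) \<Longrightarrow>
      (\<integral>\<omega>. indicator B \<omega> * \<phi> (R (u + t) \<omega>) \<partial>M)
       = (\<integral>\<omega>. indicator B \<omega> * (\<integral>y. \<phi> y \<partial>P t (R u \<omega>)) \<partial>M)" (is "_ \<Longrightarrow> ?eq")
    and kernel_integral_measurable: "(\<lambda>\<omega>. \<integral>y. \<phi> y \<partial>P t (R u \<omega>)) \<in> borel_measurable M" (is ?meas)
    and kernel_integral_nonneg: "0 \<le> (\<integral>y. \<phi> y \<partial>P t (R u \<omega>))"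
    and kernel_integral_le: "\<omega> \<in> space M \<Longrightarrow> (\<integral>y. \<phi> y \<partial>P t (R u \<omega>)) \<le> K"
proof -
  have ut: "u + t \<ge> 0" using u t by simp
  have \<phi>': "\<phi> \<in> borel_measurable half_line"
    using \<phi> by (rule measurable_restrict_space1)
  show meas [measurable]: ?meas
    using measurable_compose[OF process_measurable_half_line[OF u]
        measurable_compose[OF kernel_measurable_space[OF t] integral_measurable_subprob_algebra[OF \<phi>']]] .
  show nonneg: "0 \<le> (\<integral>y. \<phi> y \<partial>P t (R u \<omega>))" for \<omega>
    using bound by (intro integral_nonneg_AE) auto
  have int: "integrable (P t (R u \<omega>)) \<phi>" "(\<integral>y. \<phi> y \<partial>P t (R u \<omega>)) \<le> K" if "\<omega> \<in> space M" for \<omega>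
  proof -
    interpret K: prob_space "P t (R u \<omega>)" by (intro prob_space_kernel t process_nonneg u that)
    show int: "integrable (P t (R u \<omega>)) \<phi>"
      by (rule K.integrable_const_bound[of _ K])
         (use bound \<phi> u t that in \<open>auto intro!: borel_measurable_kernel process_nonneg\<close>)
    have "(\<integral>y. \<phi> y \<partial>P t (R u \<omega>)) \<le> (\<integral>y. K \<partial>P t (R u \<omega>))"
      by (intro integral_mono int bound) auto
    then show "(\<integral>y. \<phi> y \<partial>P t (R u \<omega>)) \<le> K" by (simp add: K.prob_space)
  qed
  then show "\<omega> \<in> space M \<Longrightarrow> (\<integral>y. \<phi> y \<partial>P t (R u \<omega>)) \<le> K" by simp
  assume B: "B \<in> sets (natural_filtration M R u)"
  have B' [measurable]: "B \<in> sets M"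
    using B natural_filtration_subalgebra[of u] by (auto simp: subalgebra_def)
  have [measurable]: "(\<lambda>\<omega>. \<phi> (R (u + t) \<omega>)) \<in> borel_measurable M"
    using measurable_compose[OF process_measurable[OF ut] \<phi>] .
  have "(\<integral>\<omega>. indicator B \<omega> * \<phi> (R (u + t) \<omega>) \<partial>M) = enn2real (\<integral>\<^sup>+\<omega>. ennreal (indicator B \<omega> * \<phi> (R (u + t) \<omega>)) \<partial>M)"
    using bound by (intro integral_eq_nn_integral) auto
  also have "(\<integral>\<^sup>+\<omega>. ennreal (indicator B \<omega> * \<phi> (R (u + t) \<omega>)) \<partial>M) = (\<integral>\<^sup>+\<omega>. indicator B \<omega> * ennreal (\<phi> (R (u + t) \<omega>)) \<partial>M)"
    by (intro nn_integral_cong) (auto split: split_indicator)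
  also have "\<dots> = (\<integral>\<^sup>+\<omega>. indicator B \<omega> * (\<integral>\<^sup>+y. ennreal (\<phi> y) \<partial>P t (R u \<omega>)) \<partial>M)"
    using \<phi> by (intro markov_nn_integral u t B) auto
  also have "\<dots> = (\<integral>\<^sup>+\<omega>. ennreal (indicator B \<omega> * (\<integral>y. \<phi> y \<partial>P t (R u \<omega>))) \<partial>M)"
    by (intro nn_integral_cong)
       (use int bound in \<open>auto simp: nn_integral_eq_integral split: split_indicator\<close>)
  also have "enn2real \<dots> = (\<integral>\<omega>. indicator B \<omega> * (\<integral>y. \<phi> y \<partial>P t (R u \<omega>)) \<partial>M)"
    using nonneg by (intro integral_eq_nn_integral[symmetric]) auto
  finally show ?eq .
qed

section \<open>First exit from the region above the boundary, capped at a horizon\<close>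

definition alive :: "real \<Rightarrow> 'w set" where
  "alive t = {\<omega> \<in> space M. \<forall>u\<in>{0..t}. b + u < c * (R u \<omega>)\<^sup>2}"

text \<open>With \<open>\<le>\<close> in place of equality, the relation to \<open>alive\<close>
  holds for every path, on whichever side it starts. Inserting T keeps the set nonempty and the
  value a real number in {0..T}.\<close>

definition exit_time :: "real \<Rightarrow> 'w \<Rightarrow> real" where
  "exit_time T \<omega> = Inf (insert T {u \<in> {0..T}. c * (R u \<omega>)\<^sup>2 \<le> b + u})"

lemma continuous_boundary_distance:
  "\<omega> \<in> space M \<Longrightarrow> continuous_on {0..} (\<lambda>u. c * (R u \<omega>)\<^sup>2 - (b + u))"
  by (intro continuous_intros cont)

text \<open>This is what permits the Markov property at time t to be used on the event.\<close>

lemma alive_natural_filtration: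
  assumes t: "t \<ge> 0"
  shows "alive t \<in> sets (natural_filtration M R t)"
proof -
  have "{\<omega> \<in> space (natural_filtration M R t). \<forall>u\<in>{0..t}. 0 < c * (R u \<omega>)\<^sup>2 - (b + u)}
      \<in> sets (natural_filtration M R t)"
  proof (rule sets_all_positive_until[OF t])
    fix u assume "0 \<le> u" "u \<le> t"
    then have [measurable]: "R u \<in> borel_measurable (natural_filtration M R t)"
      by (rule process_adapted)
    show "(\<lambda>\<omega>. c * (R u \<omega>)\<^sup>2 - (b + u)) \<in> borel_measurable (natural_filtration M R t)"
      by measurable
  next
    fix \<omega> assume "\<omega> \<in> space (natural_filtration M R t)"
    then show "continuous_on {0..t} (\<lambda>u. c * (R u \<omega>)\<^sup>2 - (b + u))"
      by (intro continuous_on_subset[OF continuous_boundary_distance]) auto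
  qed
  then show ?thesis by (simp add: alive_def)
qed

lemma alive_sets [measurable]: "t \<ge> 0 \<Longrightarrow> alive t \<in> sets M"
  using alive_natural_filtration natural_filtration_subalgebra by (auto simp: subalgebra_def)

text \<open>Continuity makes the set closed, so the infimum is attained. The last claim is confined
  to t < T, because a path still alive at T has exit time T as well.\<close>

lemma exit_time_props:
  assumes T: "T \<ge> 0" and \<omega>: "\<omega> \<in> space M"
  shows "0 \<le> exit_time T \<omega>" "exit_time T \<omega> \<le> T"
    and "exit_time T \<omega> = T \<or> c * (R (exit_time T \<omega>) \<omega>)\<^sup>2 \<le> b + exit_time T \<omega>"
    and "0 \<le> t \<Longrightarrow> t < T \<Longrightarrow> \<omega> \<in> alive t \<longleftrightarrow> t < exit_time T \<omega>"
proof -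
  let ?S = "{u \<in> {0..T}. c * (R u \<omega>)\<^sup>2 \<le> b + u}"
  have "continuous_on {0..T} (\<lambda>u. c * (R u \<omega>)\<^sup>2 - (b + u))"
    by (rule continuous_on_subset[OF continuous_boundary_distance[OF \<omega>]]) auto
  then have "closed ({0..T} \<inter> (\<lambda>u. c * (R u \<omega>)\<^sup>2 - (b + u)) -` {..0})"
    by (intro continuous_closed_preimage) auto
  also have "{0..T} \<inter> (\<lambda>u. c * (R u \<omega>)\<^sup>2 - (b + u)) -` {..0} = ?S" by auto
  finally have "closed (insert T ?S)" by (rule closed_insert)
  moreover have bdd: "bdd_below (insert T ?S)"
    using T by (intro bdd_belowI[of _ 0]) auto
  ultimately have in_S: "exit_time T \<omega> \<in> insert T ?S"
    unfolding exit_time_def by (intro closed_contains_Inf) auto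
  then show "0 \<le> exit_time T \<omega>" "exit_time T \<omega> \<le> T"
    "exit_time T \<omega> = T \<or> c * (R (exit_time T \<omega>) \<omega>)\<^sup>2 \<le> b + exit_time T \<omega>"
    using T by auto
  have lower: "exit_time T \<omega> \<le> u" if "u \<in> insert T ?S" for u
    unfolding exit_time_def using that bdd by (rule cInf_lower)
  assume t: "0 \<le> t" "t < T"
  show "\<omega> \<in> alive t \<longleftrightarrow> t < exit_time T \<omega>"
  proof
    assume a: "\<omega> \<in> alive t"
    show "t < exit_time T \<omega>"
    proof (rule ccontr)
      assume "\<not> t < exit_time T \<omega>"
      with t in_S have "exit_time T \<omega> \<in> ?S" "exit_time T \<omega> \<in> {0..t}" by auto
      moreover from this a have "b + exit_time T \<omega> < c * (R (exit_time T \<omega>) \<omega>)\<^sup>2"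
        unfolding alive_def by blast
      ultimately show False by simp
    qed
  next
    assume less: "t < exit_time T \<omega>"
    have "b + u < c * (R u \<omega>)\<^sup>2" if "u \<in> {0..t}" for u
    proof (rule ccontr)
      assume "\<not> b + u < c * (R u \<omega>)\<^sup>2"
      then have "u \<in> insert T ?S" using that t by simp
      from lower[OF this] that less show False by simp
    qed
    then show "\<omega> \<in> alive t" using \<omega> by (simp add: alive_def)
  qed
qed

text \<open>The boundary term at w = N per unit of time, with x^2 replaced by its lower bound b / c
  above the boundary and the time argument by its upper bound b + T.\<close>

definition exit_error :: "real \<Rightarrow> real \<Rightarrow> real \<Rightarrow> real" where
  "exit_error s N T = 2 * N powr (s + 1) * (1 + 2 * (b + T) * N) powr \<bar>\<nu> - s\<bar> * exp (- (N * (b / c)))"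

text \<open>On \<open>alive t\<close> the Markov property replaces the later value by a kernel
  integral started at x = \<open>R t \<omega>\<close>. There c * x^2 > b + t \<ge> b, so x > 0 and
  exp(- N x^2) \<le> exp(- N b / c) in the deterministic step estimate.\<close>

lemma one_step_expectation:
  fixes s N T t \<delta> :: real
  assumes s: "s > 0" and N: "N > 0" and t: "t \<ge> 0" and \<delta>: "\<delta> > 0" and T: "t + \<delta> \<le> T"
  defines "Z \<equiv> \<lambda>t \<omega>. laplace_mix (\<nu> - s) s N ((R t \<omega>)\<^sup>2) (b + t)"
  shows "\<bar>\<integral>\<omega>. indicator (alive t) \<omega> * (Z (t + \<delta>) \<omega> - Z t \<omega>) \<partial>M\<bar>
    \<le> \<delta> * exit_error s N T + step_error (\<nu> - s) s N (b + T) * \<delta>\<^sup>2"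
proof -
  define K where "K = (1 + 2 * (b + T) * N) powr \<bar>\<nu> - s\<bar> * measure (power_measure s N) UNIV"
  define \<phi> where "\<phi> y = laplace_mix (\<nu> - s) s N (y\<^sup>2) (b + (t + \<delta>))" for y
  define \<psi> where "\<psi> \<omega> = (\<integral>y. \<phi> y \<partial>P \<delta> (R t \<omega>))" for \<omega>
  have ZK: "0 \<le> Z u \<omega>" "Z u \<omega> \<le> K" if "0 \<le> u" "u \<le> T" for u \<omega>
    unfolding Z_def K_def
    by (rule laplace_mix_nonneg, rule laplace_mix_bound) (use that s N b_pos in auto)
  have [measurable]: "\<phi> \<in> borel_measurable borel"
    unfolding \<phi>_def using borel_measurable_laplace_mix[OF s] by measurable
  have \<phi>: "0 \<le> \<phi> y" "\<phi> y \<le> K" for y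
    unfolding \<phi>_def K_def
    by (rule laplace_mix_nonneg, rule laplace_mix_bound) (use s N b_pos t \<delta> T in auto)
  note markov_props = \<open>\<phi> \<in> borel_measurable borel\<close> \<phi>
  have [measurable]: "\<psi> \<in> borel_measurable M"
    unfolding \<psi>_def using kernel_integral_measurable[OF t less_imp_le[OF \<delta>] markov_props] .
  have \<psi>: "0 \<le> \<psi> \<omega>" for \<omega>
    unfolding \<psi>_def using kernel_integral_nonneg[OF t less_imp_le[OF \<delta>] markov_props] .
  have \<psi>K: "\<psi> \<omega> \<le> K" if "\<omega> \<in> space M" for \<omega>
    unfolding \<psi>_def using kernel_integral_le[OF t less_imp_le[OF \<delta>] markov_props that] .
  have Zm [measurable]: "Z u \<in> borel_measurable M" if "u \<ge> 0" for u
    unfolding Z_def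
    using measurable_compose[OF process_measurable[OF that], of "\<lambda>y. laplace_mix (\<nu> - s) s N (y\<^sup>2) (b + u)"]
      borel_measurable_laplace_mix[OF s] by measurable
  have [measurable]: "alive t \<in> sets M" using t by (rule alive_sets)
  have "t + \<delta> \<ge> 0" using t \<delta> by simp
  note [measurable] = Zm[OF t] Zm[OF this]
  have int: "integrable M (\<lambda>\<omega>. indicator (alive t) \<omega> * f \<omega>)"
    if "f \<in> borel_measurable M" "\<And>\<omega>. \<omega> \<in> space M \<Longrightarrow> \<bar>f \<omega>\<bar> \<le> K" for f :: "'w \<Rightarrow> real"
    using integrable_mult_indicator[OF \<open>alive t \<in> sets M\<close> integrable_const_bound[OF AE_I2, of f K]] that
    by simp
  have ints: "integrable M (\<lambda>\<omega>. indicator (alive t) \<omega> * Z (t + \<delta>) \<omega>)"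
    "integrable M (\<lambda>\<omega>. indicator (alive t) \<omega> * Z t \<omega>)"
    "integrable M (\<lambda>\<omega>. indicator (alive t) \<omega> * \<psi> \<omega>)"
    using ZK \<psi> \<psi>K t \<delta> T by (auto intro!: int)
  define e where "e = \<delta> * exit_error s N T + step_error (\<nu> - s) s N (b + T) * \<delta>\<^sup>2"
  have "(\<integral>\<omega>. indicator (alive t) \<omega> * Z (t + \<delta>) \<omega> \<partial>M) = (\<integral>\<omega>. indicator (alive t) \<omega> * \<psi> \<omega> \<partial>M)"
    using markov_integral[OF t less_imp_le[OF \<delta>] markov_props alive_natural_filtration[OF t]]
    by (simp add: Z_def \<phi>_def \<psi>_def)
  then have "(\<integral>\<omega>. indicator (alive t) \<omega> * (Z (t + \<delta>) \<omega> - Z t \<omega>) \<partial>M)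
      = (\<integral>\<omega>. indicator (alive t) \<omega> * (\<psi> \<omega> - Z t \<omega>) \<partial>M)"
    using ints by (simp add: right_diff_distrib)
  also have "\<bar>\<dots>\<bar> \<le> (\<integral>\<omega>. \<bar>indicator (alive t) \<omega> * (\<psi> \<omega> - Z t \<omega>)\<bar> \<partial>M)"
    by (rule integral_abs_bound)
  also have "\<dots> \<le> (\<integral>\<omega>. e \<partial>M)"
  proof (rule integral_mono)
    show "integrable M (\<lambda>\<omega>. \<bar>indicator (alive t) \<omega> * (\<psi> \<omega> - Z t \<omega>)\<bar>)"
      using ints by (auto simp: right_diff_distrib)
    fix \<omega> assume \<omega>: "\<omega> \<in> space M"
    have e0: "\<delta> * exit_error s N T \<ge> 0" "step_error (\<nu> - s) s N (b + T) * \<delta>\<^sup>2 \<ge> 0"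
      using \<nu>_pos \<delta> N b_pos t T by (auto simp: exit_error_def step_error_def drift_bound_def)
    show "\<bar>indicator (alive t) \<omega> * (\<psi> \<omega> - Z t \<omega>)\<bar> \<le> e"
    proof (cases "\<omega> \<in> alive t")
      case True
      define x where "x = R t \<omega>"
      have "b + t < c * x\<^sup>2" using True t by (simp add: alive_def x_def)
      then have x2: "b / c \<le> x\<^sup>2" using b_pos b_less_c t by (simp add: field_simps)
      moreover have "b / c > 0" using b_pos b_less_c by simp
      ultimately have "x \<noteq> 0" by auto
      then have x: "x > 0" using process_nonneg[OF t \<omega>] by (simp add: x_def)
      have "\<bar>\<psi> \<omega> - Z t \<omega>\<bar> \<le> \<delta> * (2 * N powr (s + 1) * (1 + 2 * (b + T) * N) powr \<bar>\<nu> - s\<bar> * exp (- (N * x\<^sup>2)))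
          + step_error (\<nu> - s) s N (b + T) * \<delta>\<^sup>2"
        using kernel_laplace_mix_step[OF s N x, of \<delta> "b + (t + \<delta>)" "b + T"] \<delta> b_pos t T
        by (simp add: \<psi>_def \<phi>_def Z_def x_def add.assoc)
      also have "\<dots> \<le> e"
        unfolding e_def exit_error_def
        using mult_left_mono[OF x2, of N] N \<delta> by (intro add_mono order_refl mult_left_mono) auto
      finally show ?thesis using True by simp
    qed (use e0 in \<open>simp add: e_def\<close>)
  qed simp
  finally show ?thesis by (simp add: e_def prob_space)
qed

text \<open>Optional stopping for the approximately harmonic function: the increments of Z that
  start while the path is alive telescope to the value of Z at the first grid point after the exit.
  Refining the grid moves this point to the exit time itself, and only the error linear in the step
  length survives.\<close>

lemma
  fixes s N T :: real
  assumes s: "s > 0" and N: "N > 0" and T: "T > 0"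
  defines "X \<equiv> \<lambda>\<omega>. laplace_mix (\<nu> - s) s N ((R (exit_time T \<omega>) \<omega>)\<^sup>2) (b + exit_time T \<omega>)"
  shows exit_value_measurable: "X \<in> borel_measurable M"
    and exit_expectation: "\<bar>(\<integral>\<omega>. X \<omega> \<partial>M) - laplace_mix (\<nu> - s) s N 1 b\<bar> \<le> T * exit_error s N T"
proof -
  define Z where "Z t \<omega> = laplace_mix (\<nu> - s) s N ((R t \<omega>)\<^sup>2) (b + t)" for t \<omega>
  define K where "K = (1 + 2 * (b + T) * N) powr \<bar>\<nu> - s\<bar> * measure (power_measure s N) UNIV"
  have ZK: "0 \<le> Z u \<omega>" "Z u \<omega> \<le> K" if "0 \<le> u" "u \<le> T" for u \<omega>
    unfolding Z_def K_def
    by (rule laplace_mix_nonneg, rule laplace_mix_bound) (use that s N b_pos in auto)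
  have Zm: "Z u \<in> borel_measurable M" if "u \<ge> 0" for u
    unfolding Z_def
    using measurable_compose[OF process_measurable[OF that], of "\<lambda>y. laplace_mix (\<nu> - s) s N (y\<^sup>2) (b + u)"]
      borel_measurable_laplace_mix[OF s] by measurable
  \<comment> \<open>A discrete stochastic integral: each indicator is decided at the left end of its
    step.\<close>
  define S where "S n \<omega> = Z 0 \<omega> + (\<Sum>k<Suc n. indicator (alive (real k * (T / Suc n))) \<omega>
      * (Z (real k * (T / Suc n) + T / Suc n) \<omega> - Z (real k * (T / Suc n)) \<omega>))" for n \<omega>
  define \<theta> where "\<theta> n \<omega> = T / Suc n * real (nat \<lceil>exit_time T \<omega> / (T / Suc n)\<rceil>)" for n \<omega>
  have grid: "0 \<le> real k * (T / Suc n)" "real k * (T / Suc n) + T / Suc n \<le> T"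
    "real k * (T / Suc n) < T" if "k < Suc n" for k n
  proof -
    define d where "d = T / Suc n"
    have "real (Suc k) * d \<le> real (Suc n) * d" using that T by (intro mult_right_mono) (auto simp: d_def)
    also have "real (Suc n) * d = T" by (simp add: d_def)
    finally show "real k * (T / Suc n) + T / Suc n \<le> T"
      unfolding d_def[symmetric] by (simp add: distrib_right)
    moreover have "T / Suc n > 0" using T by simp
    ultimately show "real k * (T / Suc n) < T" by linarith
  qed (use T in simp)
  have S_eq: "S n \<omega> = Z (\<theta> n \<omega>) \<omega>" if \<omega>: "\<omega> \<in> space M" for n \<omega>
  proof -
    have "S n \<omega> = Z 0 \<omega> + (\<Sum>k<Suc n. (if real k * (T / Suc n) < exit_time T \<omega>
        then Z (real (Suc k) * (T / Suc n)) \<omega> - Z (real k * (T / Suc n)) \<omega> else 0))"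
      unfolding S_def
    proof (intro arg_cong2[where f = "(+)"] refl sum.cong)
      fix k assume "k \<in> {..<Suc n}"
      then have k: "k < Suc n" by simp
      have "real (Suc k) * d = real k * d + d" for d :: real
        by (simp add: distrib_right)
      from this[of "T / Suc n"] show "indicator (alive (real k * (T / Suc n))) \<omega>
          * (Z (real k * (T / Suc n) + T / Suc n) \<omega> - Z (real k * (T / Suc n)) \<omega>)
        = (if real k * (T / Suc n) < exit_time T \<omega>
           then Z (real (Suc k) * (T / Suc n)) \<omega> - Z (real k * (T / Suc n)) \<omega> else 0)"
        using exit_time_props(4)[OF less_imp_le[OF T] \<omega> grid(1)[OF k] grid(3)[OF k]]
        by (simp add: indicator_def)
    qed
    also have "\<dots> = Z (\<theta> n \<omega>) \<omega>"
      unfolding \<theta>_def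
      by (rule sum_before_stop[where Z = "\<lambda>t. Z t \<omega>"])
         (use T exit_time_props(1,2)[OF less_imp_le[OF T] \<omega>] in auto)
    finally show ?thesis .
  qed
  have \<theta>: "exit_time T \<omega> \<le> \<theta> n \<omega>" "\<theta> n \<omega> \<le> exit_time T \<omega> + T / Suc n" "\<theta> n \<omega> \<le> T"
    if \<omega>: "\<omega> \<in> space M" for n \<omega>
  proof -
    define d where "d = T / Suc n"
    define u where "u = exit_time T \<omega>"
    have d: "d > 0" using T by (simp add: d_def)
    have u: "0 \<le> u" "u \<le> T" using exit_time_props(1,2)[OF less_imp_le[OF T] \<omega>] by (auto simp: u_def)
    define m where "m = nat \<lceil>u / d\<rceil>"
    have "0 \<le> u / d" using u d by simp
    then have m: "u / d \<le> real m" "real m \<le> u / d + 1" unfolding m_def by linarith+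
    then have "u \<le> d * real m" "d * real m \<le> u + d"
      using d by (simp_all add: field_simps)
    moreover have \<theta>_eq: "\<theta> n \<omega> = d * real m"
      by (simp only: \<theta>_def d_def m_def u_def)
    ultimately show "exit_time T \<omega> \<le> \<theta> n \<omega>" "\<theta> n \<omega> \<le> exit_time T \<omega> + T / Suc n"
      by (simp_all only: u_def d_def)
    have "u / d \<le> T / d" using u d by (intro divide_right_mono) auto
    also have "T / d = real (Suc n)" using T by (simp add: d_def)
    finally have "u / d \<le> real (Suc n)" .
    then have "m \<le> Suc n" unfolding m_def by linarith
    then have "d * real m \<le> d * real (Suc n)" using d by (intro mult_left_mono) auto
    also have "\<dots> = T" by (simp add: d_def)
    finally show "\<theta> n \<omega> \<le> T" by (simp only: \<theta>_eq)
  qed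
  have lim: "(\<lambda>n. S n \<omega>) \<longlonglongrightarrow> X \<omega>" if \<omega>: "\<omega> \<in> space M" for \<omega>
  proof -
    have u: "0 \<le> exit_time T \<omega>" using exit_time_props(1)[OF less_imp_le[OF T] \<omega>] .
    have "(\<lambda>n. exit_time T \<omega> + T / Suc n) \<longlonglongrightarrow> exit_time T \<omega> + 0"
      by (intro tendsto_intros) real_asymp
    then have upper: "(\<lambda>n. exit_time T \<omega> + T / Suc n) \<longlonglongrightarrow> exit_time T \<omega>"
      by (simp only: add_0_right)
    have \<theta>_lim: "(\<lambda>n. \<theta> n \<omega>) \<longlonglongrightarrow> exit_time T \<omega>"
      by (rule tendsto_sandwich[OF always_eventually always_eventually tendsto_const upper])
         (intro allI \<theta>[OF \<omega>])+
    have \<theta>0: "0 \<le> \<theta> n \<omega>" for n using u \<theta>(1)[OF \<omega>, of n] by linarith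
    have R_lim: "(\<lambda>n. R (\<theta> n \<omega>) \<omega>) \<longlonglongrightarrow> R (exit_time T \<omega>) \<omega>"
      by (rule continuous_on_tendsto_compose[OF cont[OF \<omega>] \<theta>_lim])
         (use u \<theta>0 in auto)
    have "(\<lambda>n. Z (\<theta> n \<omega>) \<omega>) \<longlonglongrightarrow> X \<omega>"
      unfolding Z_def X_def
    proof (rule tendsto_laplace_mix[OF s N, where U = "b + T"])
      show "(\<lambda>n. (R (\<theta> n \<omega>) \<omega>)\<^sup>2) \<longlonglongrightarrow> (R (exit_time T \<omega>) \<omega>)\<^sup>2"
        by (intro tendsto_intros R_lim)
      show "(\<lambda>n. b + \<theta> n \<omega>) \<longlonglongrightarrow> b + exit_time T \<omega>"
        by (intro tendsto_intros \<theta>_lim)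
    qed (use \<theta>0 \<theta>(3)[OF \<omega>] b_pos in auto)
    then show ?thesis by (simp add: S_eq[OF \<omega>])
  qed
  have Sm: "S n \<in> borel_measurable M" for n
    unfolding S_def
    using T by (intro borel_measurable_add borel_measurable_sum borel_measurable_times
        borel_measurable_diff borel_measurable_indicator Zm alive_sets) auto
  \<comment> \<open>Measurability of the stopped value is inherited from the sums
    \<open>S n\<close>, which involve only fixed times and the events \<open>alive\<close>.\<close>
  show "X \<in> borel_measurable M"
    using borel_measurable_LIMSEQ_real[OF lim Sm] by simp
  have "(\<lambda>n. \<integral>\<omega>. S n \<omega> \<partial>M) \<longlonglongrightarrow> (\<integral>\<omega>. X \<omega> \<partial>M)"
  proof (rule integral_dominated_convergence[where w = "\<lambda>_. K"])
    show "X \<in> borel_measurable M" by fact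
    show "AE \<omega> in M. norm (S n \<omega>) \<le> K" for n
    proof (rule AE_I2)
      fix \<omega> assume \<omega>: "\<omega> \<in> space M"
      have "0 \<le> \<theta> n \<omega>"
        using \<theta>(1)[OF \<omega>, of n] exit_time_props(1)[OF less_imp_le[OF T] \<omega>] by linarith
      then show "norm (S n \<omega>) \<le> K"
        using ZK[of "\<theta> n \<omega>" \<omega>] \<theta>(3)[OF \<omega>, of n] by (simp add: S_eq[OF \<omega>])
    qed
  qed (use lim Sm in auto)
  moreover have "(\<integral>\<omega>. Z 0 \<omega> \<partial>M) = laplace_mix (\<nu> - s) s N 1 b"
  proof -
    have "(\<integral>\<omega>. Z 0 \<omega> \<partial>M) = (\<integral>\<omega>. laplace_mix (\<nu> - s) s N 1 b \<partial>M)"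
    proof (rule integral_cong_AE)
      show "AE \<omega> in M. Z 0 \<omega> = laplace_mix (\<nu> - s) s N 1 b"
        using start by (auto simp: Z_def elim!: eventually_mono)
    qed (use Zm[of 0] in auto)
    then show ?thesis by (simp add: prob_space)
  qed
  ultimately have conv: "(\<lambda>n. \<bar>(\<integral>\<omega>. S n \<omega> \<partial>M) - (\<integral>\<omega>. Z 0 \<omega> \<partial>M)\<bar>)
      \<longlonglongrightarrow> \<bar>(\<integral>\<omega>. X \<omega> \<partial>M) - laplace_mix (\<nu> - s) s N 1 b\<bar>"
    by (intro tendsto_intros) auto
  have bound: "\<bar>(\<integral>\<omega>. S n \<omega> \<partial>M) - (\<integral>\<omega>. Z 0 \<omega> \<partial>M)\<bar>
      \<le> T * exit_error s N T + step_error (\<nu> - s) s N (b + T) * T\<^sup>2 / Suc n" for n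
  proof -
    define d where "d = T / Suc n"
    have d: "d > 0" using T by (simp add: d_def)
    define Y where "Y k \<omega> = indicator (alive (real k * d)) \<omega> * (Z (real k * d + d) \<omega> - Z (real k * d) \<omega>)" for k \<omega>
    have Zi: "integrable M (Z u)" if "0 \<le> u" "u \<le> T" for u
      by (rule integrable_const_bound[of _ K]) (use ZK[OF that] Zm that in auto)
    have Yi: "integrable M (Y k)" if "k < Suc n" for k
      unfolding Y_def using grid[OF that] d
      by (intro Bochner_Integration.integrable_bound[OF Bochner_Integration.integrable_diff[OF Zi Zi], of "real k * d + d" "real k * d"]
            borel_measurable_times borel_measurable_diff borel_measurable_indicator Zm alive_sets)
         (auto simp: d_def split: split_indicator)
    have "(\<integral>\<omega>. S n \<omega> \<partial>M) = (\<integral>\<omega>. Z 0 \<omega> \<partial>M) + (\<Sum>k<Suc n. \<integral>\<omega>. Y k \<omega> \<partial>M)"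
      unfolding S_def d_def[symmetric] Y_def[symmetric]
      using Zi Yi T by (subst Bochner_Integration.integral_add) (auto simp del: sum.lessThan_Suc intro!: Bochner_Integration.integral_sum Bochner_Integration.integrable_sum)
    then have "\<bar>(\<integral>\<omega>. S n \<omega> \<partial>M) - (\<integral>\<omega>. Z 0 \<omega> \<partial>M)\<bar> \<le> (\<Sum>k<Suc n. \<bar>\<integral>\<omega>. Y k \<omega> \<partial>M\<bar>)"
      by (simp only: add_diff_cancel_left' sum_abs)
    also have "\<dots> \<le> (\<Sum>k<Suc n. d * exit_error s N T + step_error (\<nu> - s) s N (b + T) * d\<^sup>2)"
      unfolding Y_def Z_def
      using grid d by (intro sum_mono one_step_expectation s N) (auto simp: d_def)
    also have "\<dots> = real (Suc n) * (d * exit_error s N T + step_error (\<nu> - s) s N (b + T) * d\<^sup>2)"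
      by simp
    \<comment> \<open>The number of steps times d is T, so the quadratic errors add up to T * d,
      which vanishes with the mesh.\<close>
    also have "\<dots> = (real (Suc n) * d) * exit_error s N T + step_error (\<nu> - s) s N (b + T) * (real (Suc n) * d) * d"
      by (simp only: distrib_left power2_eq_square mult_ac)
    also have "real (Suc n) * d = T" by (simp add: d_def)
    also have "step_error (\<nu> - s) s N (b + T) * T * d = step_error (\<nu> - s) s N (b + T) * T\<^sup>2 / Suc n"
      by (simp add: d_def power2_eq_square)
    finally show ?thesis .
  qed
  have "(\<lambda>n. T * exit_error s N T + step_error (\<nu> - s) s N (b + T) * T\<^sup>2 / Suc n)
      \<longlonglongrightarrow> T * exit_error s N T + 0"
    by (intro tendsto_intros) real_asymp
  from tendsto_le[OF _ this conv] bound
  show "\<bar>(\<integral>\<omega>. X \<omega> \<partial>M) - laplace_mix (\<nu> - s) s N 1 b\<bar> \<le> T * exit_error s N T"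
    by simp
qed

section \<open>The hitting time\<close>

text \<open>The path starts strictly above the boundary because b < c, stays there before the exit,
  and the weak inequality passes to the exit time by continuity. This covers paths stopped by the
  horizon too.\<close>

lemma exit_above_boundary:
  assumes \<omega>: "\<omega> \<in> space M" and R0: "R 0 \<omega> = 1" and T: "T > 0"
  shows "b + exit_time T \<omega> \<le> c * (R (exit_time T \<omega>) \<omega>)\<^sup>2"
proof -
  define e where "e = exit_time T \<omega>"
  have e: "0 \<le> e" "e \<le> T" using exit_time_props(1,2)[OF less_imp_le[OF T] \<omega>] by (auto simp: e_def)
  have "\<omega> \<in> alive 0" using \<omega> R0 b_less_c by (simp add: alive_def)
  then have "0 < e" using exit_time_props(4)[OF less_imp_le[OF T] \<omega>, of 0] T by (simp add: e_def)
  then have cl: "closure {0..<e} = {0..e}" by simp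
  have "continuous_on (closure {0..<e}) (\<lambda>u. c * (R u \<omega>)\<^sup>2 - (b + u))"
    unfolding cl by (rule continuous_on_subset[OF continuous_boundary_distance[OF \<omega>]]) auto
  then have "0 \<le> c * (R e \<omega>)\<^sup>2 - (b + e)"
  proof (rule continuous_ge_on_closure)
    show "e \<in> closure {0..<e}" unfolding cl using e by simp
    fix t assume t: "t \<in> {0..<e}"
    then have "\<omega> \<in> alive t"
      using exit_time_props(4)[OF less_imp_le[OF T] \<omega>, of t] e by (simp add: e_def)
    then show "0 \<le> c * (R t \<omega>)\<^sup>2 - (b + t)" using t by (auto simp: alive_def intro: less_imp_le)
  qed
  then show ?thesis by (simp add: e_def)
qed

lemma hitting_time_nonneg: "0 \<le> hitting_time b c R \<omega>"
  unfolding hitting_time_def by (rule Inf_greatest) auto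

lemma boundary_iff: "(R u \<omega>)\<^sup>2 = 1 / c * (b + u) \<longleftrightarrow> c * (R u \<omega>)\<^sup>2 = b + u"
  using b_pos b_less_c by (auto simp: field_simps)

lemma hitting_time_le: "0 \<le> u \<Longrightarrow> c * (R u \<omega>)\<^sup>2 = b + u \<Longrightarrow> hitting_time b c R \<omega> \<le> ereal u"
  unfolding hitting_time_def boundary_iff by (rule Inf_lower) auto

text \<open>An exit before the horizon happens on or below the boundary, and it is also on or above
  it, hence a hit. No earlier hit exists, since the path is alive until then.\<close>

lemma exit_time_hits:
  assumes \<omega>: "\<omega> \<in> space M" and R0: "R 0 \<omega> = 1" and T: "T > 0" and less: "exit_time T \<omega> < T"
  shows "c * (R (exit_time T \<omega>) \<omega>)\<^sup>2 = b + exit_time T \<omega>"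
    and "hitting_time b c R \<omega> = ereal (exit_time T \<omega>)"
proof -
  show hit: "c * (R (exit_time T \<omega>) \<omega>)\<^sup>2 = b + exit_time T \<omega>"
    using exit_above_boundary[OF \<omega> R0 T] exit_time_props(3)[OF less_imp_le[OF T] \<omega>] less by auto
  have "ereal (exit_time T \<omega>) \<le> hitting_time b c R \<omega>"
    unfolding hitting_time_def boundary_iff
  proof (rule Inf_greatest)
    fix y assume "y \<in> {ereal u |u. 0 \<le> u \<and> c * (R u \<omega>)\<^sup>2 = b + u}"
    then obtain u where u: "y = ereal u" "0 \<le> u" "c * (R u \<omega>)\<^sup>2 = b + u" by auto
    have "\<not> u < exit_time T \<omega>"
    proof
      assume "u < exit_time T \<omega>"
      then have "\<omega> \<in> alive u"
        using exit_time_props(4)[OF less_imp_le[OF T] \<omega> u(2)] less by simp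
      then show False using u by (auto simp: alive_def dest!: bspec[of _ _ u])
    qed
    then show "ereal (exit_time T \<omega>) \<le> y" by (simp add: u)
  qed
  with hitting_time_le[OF exit_time_props(1)[OF less_imp_le[OF T] \<omega>] hit]
  show "hitting_time b c R \<omega> = ereal (exit_time T \<omega>)" by (rule antisym)
qed

lemma exit_time_before_hitting:
  assumes \<omega>: "\<omega> \<in> space M" and T: "T > 0" and u: "0 \<le> u" "u < T" "c * (R u \<omega>)\<^sup>2 = b + u"
  shows "exit_time T \<omega> < T"
proof (rule ccontr)
  assume "\<not> exit_time T \<omega> < T"
  then have "\<omega> \<in> alive u"
    using exit_time_props(4)[OF less_imp_le[OF T] \<omega> u(1,2)] u(2) by simp
  then show False using u by (auto simp: alive_def dest!: bspec[of _ _ u])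
qed

text \<open>By the intermediate value theorem a path that avoids the boundary stays on one side of
  it, so the event is a union of two positivity events.\<close>

lemma no_hit_sets:
  assumes t: "t \<ge> 0"
  shows "{\<omega> \<in> space M. \<forall>u\<in>{0..t}. c * (R u \<omega>)\<^sup>2 \<noteq> b + u} \<in> sets M"
proof -
  let ?H = "\<lambda>u \<omega>. c * (R u \<omega>)\<^sup>2 - (b + u)"
  have ct: "continuous_on {0..t} (\<lambda>u. ?H u \<omega>)" if "\<omega> \<in> space M" for \<omega>
    by (rule continuous_on_subset[OF continuous_boundary_distance[OF that]]) auto
  have meas: "?H u \<in> borel_measurable M" if "0 \<le> u" for u
    using process_measurable[OF that] by measurable
  have "{\<omega> \<in> space M. \<forall>u\<in>{0..t}. c * (R u \<omega>)\<^sup>2 \<noteq> b + u}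
      = {\<omega> \<in> space M. \<forall>u\<in>{0..t}. 0 < ?H u \<omega>} \<union> {\<omega> \<in> space M. \<forall>u\<in>{0..t}. 0 < - ?H u \<omega>}"
  proof (intro equalityI subsetI)
    fix \<omega> assume \<omega>: "\<omega> \<in> {\<omega> \<in> space M. \<forall>u\<in>{0..t}. c * (R u \<omega>)\<^sup>2 \<noteq> b + u}"
    then have sp: "\<omega> \<in> space M" by simp
    show "\<omega> \<in> {\<omega> \<in> space M. \<forall>u\<in>{0..t}. 0 < ?H u \<omega>} \<union> {\<omega> \<in> space M. \<forall>u\<in>{0..t}. 0 < - ?H u \<omega>}"
    proof (rule ccontr)
      assume "\<not> ?thesis"
      with sp obtain u v where uv: "u \<in> {0..t}" "?H u \<omega> \<le> 0" "v \<in> {0..t}" "0 \<le> ?H v \<omega>"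
        by (auto simp: not_less)
      have "connected ((\<lambda>u. ?H u \<omega>) ` {0..t})"
        by (rule connected_continuous_image[OF ct[OF sp]]) simp
      then have "{?H u \<omega>..?H v \<omega>} \<subseteq> (\<lambda>u. ?H u \<omega>) ` {0..t}"
        using uv by (intro connected_contains_Icc) auto
      with uv have "0 \<in> (\<lambda>u. ?H u \<omega>) ` {0..t}" by (simp add: subset_eq)
      with \<omega> show False by auto
    qed
  next
    fix \<omega> assume "\<omega> \<in> {\<omega> \<in> space M. \<forall>u\<in>{0..t}. 0 < ?H u \<omega>} \<union> {\<omega> \<in> space M. \<forall>u\<in>{0..t}. 0 < - ?H u \<omega>}"
    then show "\<omega> \<in> {\<omega> \<in> space M. \<forall>u\<in>{0..t}. c * (R u \<omega>)\<^sup>2 \<noteq> b + u}"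
      by force
  qed
  also have "\<dots> \<in> sets M"
    by (intro sets.Un sets_all_positive_until t meas ct borel_measurable_uminus continuous_on_minus)
  finally show ?thesis .
qed

text \<open>The hitting time is at least y exactly when no hit occurs on {0..q} for any rational q
  \<ge> 0 below y.\<close>

lemma hitting_time_measurable: "hitting_time b c R \<in> borel_measurable M"
proof (rule borel_measurableI_ge)
  fix y :: ereal
  show "{\<omega> \<in> space M. y \<le> hitting_time b c R \<omega>} \<in> sets M"
  proof (cases "y \<le> 0")
    case True
    then have "{\<omega> \<in> space M. y \<le> hitting_time b c R \<omega>} = space M"
      using hitting_time_nonneg order_trans by blast
    then show ?thesis by simp
  next
    case False
    \<comment> \<open>It contains 0 because y > 0; nonemptiness keeps the intersection below inside
      the space of M.\<close>
    define Q where "Q = {q \<in> \<rat>. 0 \<le> q \<and> ereal q < y}"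
    have Q: "countable Q" "Q \<noteq> {}"
      using False countable_rat by (auto simp: Q_def zero_ereal_def intro: countable_subset[OF _ countable_rat])
    have "{\<omega> \<in> space M. y \<le> hitting_time b c R \<omega>}
        = (\<Inter>q\<in>Q. {\<omega> \<in> space M. \<forall>u\<in>{0..q}. c * (R u \<omega>)\<^sup>2 \<noteq> b + u})"
    proof (intro equalityI subsetI)
      fix \<omega> assume \<omega>: "\<omega> \<in> {\<omega> \<in> space M. y \<le> hitting_time b c R \<omega>}"
      have "c * (R u \<omega>)\<^sup>2 \<noteq> b + u" if "q \<in> Q" "u \<in> {0..q}" for q u
      proof
        assume "c * (R u \<omega>)\<^sup>2 = b + u"
        then have "hitting_time b c R \<omega> \<le> ereal u"
          using that by (intro hitting_time_le) auto
        also have "\<dots> \<le> ereal q" using that by simp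
        also have "\<dots> < y" using that by (simp add: Q_def)
        finally have "\<not> y \<le> hitting_time b c R \<omega>" by (simp only: not_le)
        then show False using \<omega> by blast
      qed
      with \<omega> show "\<omega> \<in> (\<Inter>q\<in>Q. {\<omega> \<in> space M. \<forall>u\<in>{0..q}. c * (R u \<omega>)\<^sup>2 \<noteq> b + u})"
        by blast
    next
      fix \<omega> assume \<omega>: "\<omega> \<in> (\<Inter>q\<in>Q. {\<omega> \<in> space M. \<forall>u\<in>{0..q}. c * (R u \<omega>)\<^sup>2 \<noteq> b + u})"
      with Q have sp: "\<omega> \<in> space M" by blast
      have "y \<le> hitting_time b c R \<omega>"
        unfolding hitting_time_def boundary_iff
      proof (rule Inf_greatest, rule ccontr)
        fix v assume "v \<in> {ereal u |u. 0 \<le> u \<and> c * (R u \<omega>)\<^sup>2 = b + u}" "\<not> y \<le> v"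
        then obtain u where u: "0 \<le> u" "c * (R u \<omega>)\<^sup>2 = b + u" "ereal u < y" by auto
        \<comment> \<open>As y may be \<infinity>, a real number is interposed before a rational is
          chosen.\<close>
        from ereal_dense2[OF u(3)] obtain q' where q': "ereal u < ereal q'" "ereal q' < y" by blast
        obtain q where q: "q \<in> \<rat>" "u < q" "q < q'" using Rats_dense_in_real[of u q'] q' by auto
        then have "ereal q < y" using q' by (meson ereal_less(3) less_ereal.simps(1) order.strict_trans)
        with q u have "q \<in> Q" by (simp add: Q_def)
        with \<omega> u q show False by force
      qed
      with sp show "\<omega> \<in> {\<omega> \<in> space M. y \<le> hitting_time b c R \<omega>}" by simp
    qed
    also have "\<dots> \<in> sets M"
      using Q by (intro sets.countable_INT' image_subsetI no_hit_sets) (auto simp: Q_def)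
    finally show ?thesis .
  qed
qed

section \<open>Moments of the hitting time\<close>

lemma neg_power_hitting_measurable:
  "(\<lambda>\<omega>. neg_power b s (hitting_time b c R \<omega>)) \<in> borel_measurable M"
  unfolding neg_power_def using hitting_time_measurable by measurable

lemma neg_power_bounds:
  assumes "\<tau> \<ge> 0" "s \<ge> 0"
  shows "0 \<le> neg_power b s \<tau>" "neg_power b s \<tau> \<le> b powr (- s)"
proof -
  have "(b + real_of_ereal \<tau>) powr (- s) \<le> b powr (- s)" if "\<tau> \<noteq> \<infinity>"
    using assms b_pos that by (intro powr_mono2') (auto intro: real_of_ereal_pos)
  then show "0 \<le> neg_power b s \<tau>" "neg_power b s \<tau> \<le> b powr (- s)"
    by (auto simp: neg_power_def)
qed

text \<open>Cut-off and horizon grow together. If the path hits, the exit time is eventually the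
  hitting time, and the mixture converges at a fixed boundary point, where the ratio of time to
  squared space is c. If not, the exit time is the horizon and the value is at most a multiple of
  ((b + horizon) / c)^(- s), which tends to 0 in accordance with \<open>neg_power\<close> at
  \<infinity>.\<close>

lemma exit_value_tendsto:
  fixes p s :: real
  assumes s: "s > 0" and \<omega>: "\<omega> \<in> space M" and R0: "R 0 \<omega> = 1"
  defines "X \<equiv> \<lambda>n. laplace_mix p s (real (Suc n)) ((R (exit_time (real (Suc n)) \<omega>) \<omega>)\<^sup>2) (b + exit_time (real (Suc n)) \<omega>)"
  shows "X \<longlonglongrightarrow> neg_power b s (hitting_time b c R \<omega>) * (c powr s * gamma_mix s p c)"
    and "0 \<le> X n" "X n \<le> (b / c) powr (- s) * gamma_mix s \<bar>p\<bar> c"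
proof -
  have c: "c > 0" using b_pos b_less_c by simp
  define u where "u n = exit_time (real (Suc n)) \<omega>" for n
  define z where "z n = (R (u n) \<omega>)\<^sup>2" for n
  have u0: "0 \<le> u n" for n unfolding u_def by (rule exit_time_props(1)[OF _ \<omega>]) simp
  have z: "(b + u n) / c \<le> z n" for n
    using exit_above_boundary[OF \<omega> R0, of "real (Suc n)"] c by (simp add: z_def u_def field_simps)
  have low: "0 < (b + u n) / c" for n using b_pos c u0[of n] by (auto intro: add_pos_nonneg)
  have G: "gamma_mix s \<bar>p\<bar> c > 0" using s c by (rule gamma_mix_pos)
  \<comment> \<open>Lying on or above the boundary is used twice: it bounds the ratio (b + u) / z by
    c, and it bounds z from below.\<close>
  have X_le: "X n \<le> ((b + u n) / c) powr (- s) * gamma_mix s \<bar>p\<bar> c" for n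
  proof -
    have zp: "z n > 0" using z[of n] low[of n] by linarith
    have "X n \<le> z n powr (- s) * gamma_mix s \<bar>p\<bar> c"
      unfolding X_def u_def[symmetric] z_def[symmetric]
    proof (rule laplace_mix_le_gamma_mix[OF s zp])
      show "(b + u n) / z n \<le> c" using z[of n] zp c by (simp add: field_simps)
    qed (use b_pos u0[of n] c in auto)
    also have "z n powr (- s) \<le> ((b + u n) / c) powr (- s)"
      using z[of n] low[of n] s by (intro powr_mono2') auto
    finally show ?thesis using G by simp
  qed
  show "0 \<le> X n" by (simp add: X_def laplace_mix_nonneg)
  have "((b + u n) / c) powr (- s) \<le> (b / c) powr (- s)"
    using b_pos c u0[of n] s by (intro powr_mono2') (auto simp: divide_right_mono)
  then have "((b + u n) / c) powr (- s) * gamma_mix s \<bar>p\<bar> c \<le> (b / c) powr (- s) * gamma_mix s \<bar>p\<bar> c"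
    using G by (intro mult_right_mono) auto
  with X_le[of n] show "X n \<le> (b / c) powr (- s) * gamma_mix s \<bar>p\<bar> c" by linarith
  show "X \<longlonglongrightarrow> neg_power b s (hitting_time b c R \<omega>) * (c powr s * gamma_mix s p c)"
  proof (cases "\<exists>n. u n < real (Suc n)")
    case True
    then obtain m where m: "u m < real (Suc m)" by blast
    define v where "v = u m"
    have v0: "0 \<le> v" using u0 by (simp add: v_def)
    have hit: "c * (R v \<omega>)\<^sup>2 = b + v" and \<sigma>: "hitting_time b c R \<omega> = ereal v"
      using exit_time_hits[OF \<omega> R0, of "real (Suc m)"] m by (auto simp: v_def u_def)
    have un: "u n = v" if "n \<ge> m" for n
    proof -
      have "v < real (Suc n)" using m that unfolding v_def by simp
      then have "u n < real (Suc n)"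
        unfolding u_def using v0 hit by (intro exit_time_before_hitting[OF \<omega>]) auto
      then have "hitting_time b c R \<omega> = ereal (u n)"
        unfolding u_def by (intro exit_time_hits[OF \<omega> R0]) auto
      with \<sigma> show ?thesis by simp
    qed
    define y where "y = (b + v) / c"
    have y: "y > 0" "(R v \<omega>)\<^sup>2 = y" "(b + v) / y = c"
      using hit c b_pos v0 by (auto simp: y_def field_simps add_pos_nonneg)
    have "(\<lambda>n. laplace_mix p s (real (Suc n)) y (b + v)) \<longlonglongrightarrow> y powr (- s) * gamma_mix s p ((b + v) / y)"
      using y b_pos v0 by (intro laplace_mix_tendsto_gamma_mix s) auto
    moreover have "eventually (\<lambda>n. laplace_mix p s (real (Suc n)) y (b + v) = X n) sequentially"
      using eventually_ge_at_top[of m]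
      by eventually_elim (simp only: X_def u_def[symmetric] un y(2))
    ultimately have "X \<longlonglongrightarrow> y powr (- s) * gamma_mix s p ((b + v) / y)"
      by (rule Lim_transform_eventually)
    moreover have "y powr (- s) = (b + v) powr (- s) * c powr s"
      using b_pos c v0 by (simp add: y_def powr_divide powr_minus field_simps)
    ultimately show ?thesis
      using y by (simp add: neg_power_def \<sigma> mult.assoc)
  next
    case False
    have un: "u n = real (Suc n)" for n
    proof (rule antisym)
      show "u n \<le> real (Suc n)"
        unfolding u_def by (rule exit_time_props(2)[OF _ \<omega>]) simp
      show "real (Suc n) \<le> u n" using False not_less by blast
    qed
    have "hitting_time b c R \<omega> = \<infinity>"
    proof (rule ccontr)
      assume "hitting_time b c R \<omega> \<noteq> \<infinity>"
      then have "{ereal u |u. 0 \<le> u \<and> c * (R u \<omega>)\<^sup>2 = b + u} \<noteq> {}"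
        unfolding hitting_time_def boundary_iff by (metis Inf_empty top_ereal_def)
      then obtain v where v: "0 \<le> v" "c * (R v \<omega>)\<^sup>2 = b + v" by auto
      obtain n where "v < real n" using reals_Archimedean2 by blast
      then have "v < real (Suc n)" by simp
      then have "u n < real (Suc n)"
        unfolding u_def using v by (intro exit_time_before_hitting[OF \<omega>]) auto
      with un show False by simp
    qed
    moreover have "(\<lambda>n. ((b + u n) / c) powr (- s) * gamma_mix s \<bar>p\<bar> c) \<longlonglongrightarrow> 0"
      unfolding un using s b_pos c by real_asymp
    then have "X \<longlonglongrightarrow> 0"
      using X_le laplace_mix_nonneg
      by (intro tendsto_sandwich[OF always_eventually always_eventually tendsto_const, of 0 X])
         (simp_all add: X_def)
    ultimately show ?thesis by (simp add: neg_power_def)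
  qed
qed

text \<open>Limit of \<open>exit_expectation\<close> with N = T. The stopped value converges by
  dominated convergence, the starting value tends to the gamma integral at b, and the error is of
  polynomial growth times exp(- N b / c).\<close>

lemma moment_identity:
  assumes s: "s > 0"
  shows "(\<integral>\<omega>. neg_power b s (hitting_time b c R \<omega>) \<partial>M) * (c powr s * gamma_mix s (\<nu> - s) c) = gamma_mix s (\<nu> - s) b"
proof -
  define X where "X n \<omega> = laplace_mix (\<nu> - s) s (real (Suc n))
    ((R (exit_time (real (Suc n)) \<omega>) \<omega>)\<^sup>2) (b + exit_time (real (Suc n)) \<omega>)" for n \<omega>
  define K where "K = (b / c) powr (- s) * gamma_mix s \<bar>\<nu> - s\<bar> c"
  have Xm: "X n \<in> borel_measurable M" for n
    unfolding X_def by (rule exit_value_measurable[OF s]) auto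
  have "(\<lambda>n. \<integral>\<omega>. X n \<omega> \<partial>M)
      \<longlonglongrightarrow> (\<integral>\<omega>. neg_power b s (hitting_time b c R \<omega>) * (c powr s * gamma_mix s (\<nu> - s) c) \<partial>M)"
  proof (rule integral_dominated_convergence[where w = "\<lambda>_. K"])
    show "AE \<omega> in M. (\<lambda>n. X n \<omega>) \<longlonglongrightarrow> neg_power b s (hitting_time b c R \<omega>) * (c powr s * gamma_mix s (\<nu> - s) c)"
      using start AE_space
      by eventually_elim (unfold X_def, rule exit_value_tendsto(1)[OF s])
    show "AE \<omega> in M. norm (X n \<omega>) \<le> K" for n
      using start AE_space
    proof eventually_elim
      case (elim \<omega>)
      then show ?case
        using exit_value_tendsto(2,3)[OF s elim(2,1), of "\<nu> - s" n] by (simp add: X_def K_def)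
    qed
  qed (use Xm neg_power_hitting_measurable in auto)
  moreover have "(\<lambda>n. (\<integral>\<omega>. X n \<omega> \<partial>M) - laplace_mix (\<nu> - s) s (real (Suc n)) 1 b) \<longlonglongrightarrow> 0"
  proof (rule Lim_null_comparison)
    show "eventually (\<lambda>n. norm ((\<integral>\<omega>. X n \<omega> \<partial>M) - laplace_mix (\<nu> - s) s (real (Suc n)) 1 b)
        \<le> real (Suc n) * exit_error s (real (Suc n)) (real (Suc n))) sequentially"
      unfolding X_def real_norm_def
      by (intro always_eventually allI exit_expectation s) auto
    have "b / c > 0" using b_pos b_less_c by simp
    then show "(\<lambda>n. real (Suc n) * exit_error s (real (Suc n)) (real (Suc n))) \<longlonglongrightarrow> 0"
      unfolding exit_error_def using s b_pos
    proof -
      define k q where "k = b / c" and "q = \<bar>\<nu> - s\<bar>"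
      assume "b / c > 0"
      then have k: "k > 0" by (simp add: k_def)
      show "(\<lambda>n. real (Suc n) * (2 * real (Suc n) powr (s + 1) * (1 + 2 * (b + real (Suc n)) * real (Suc n)) powr \<bar>\<nu> - s\<bar> * exp (- (real (Suc n) * (b / c))))) \<longlonglongrightarrow> 0"
        unfolding k_def[symmetric] q_def[symmetric] using k s b_pos by real_asymp
    qed
  qed
  ultimately have "(\<lambda>n. (\<integral>\<omega>. X n \<omega> \<partial>M) - ((\<integral>\<omega>. X n \<omega> \<partial>M) - laplace_mix (\<nu> - s) s (real (Suc n)) 1 b))
      \<longlonglongrightarrow> (\<integral>\<omega>. neg_power b s (hitting_time b c R \<omega>) * (c powr s * gamma_mix s (\<nu> - s) c) \<partial>M) - 0"
    by (rule tendsto_diff)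
  then have "(\<lambda>n. laplace_mix (\<nu> - s) s (real (Suc n)) 1 b)
      \<longlonglongrightarrow> (\<integral>\<omega>. neg_power b s (hitting_time b c R \<omega>) * (c powr s * gamma_mix s (\<nu> - s) c) \<partial>M)"
    by simp
  moreover have "(\<lambda>n. laplace_mix (\<nu> - s) s (real (Suc n)) 1 b) \<longlonglongrightarrow> 1 powr (- s) * gamma_mix s (\<nu> - s) (b / 1)"
    using s b_pos by (intro laplace_mix_tendsto_gamma_mix) auto
  ultimately show ?thesis
    using LIMSEQ_unique by fastforce
qed

lemma moment_formula:
  assumes s: "s > 0"
  shows "(\<integral>\<omega>. neg_power b s (hitting_time b c R \<omega>) \<partial>M)
    = c powr (- s) * ((LINT x|gamma_law s. (1 + 2 * b * x) powr (- s + \<nu>))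
                     / (LINT x|gamma_law s. (1 + 2 * c * x) powr (- s + \<nu>)))"
proof -
  have c: "c > 0" using b_pos b_less_c by simp
  have law: "(LINT x|gamma_law s. (1 + 2 * a * x) powr (- s + \<nu>)) = rGamma s * gamma_mix s (\<nu> - s) a" for a
    by (subst gamma_law_integral[OF s]) (auto simp: gamma_mix_def)
  have "rGamma s \<noteq> 0" using Gamma_real_pos[OF s] by (simp add: rGamma_inverse_Gamma)
  moreover have "gamma_mix s (\<nu> - s) c > 0" using s c by (rule gamma_mix_pos)
  moreover have "c powr s > 0" using c by simp
  ultimately show ?thesis
    using moment_identity[OF s] unfolding law by (simp add: powr_minus field_simps)
qed

text \<open>For s = 0 the integrand is the indicator of a finite hitting time. Along s = 1 / (n + 1)
  it is the pointwise limit of the integrands for positive s, while both gamma expectations tend to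
  1; hence the boundary is hit almost surely.\<close>

lemma hitting_probability: "(\<integral>\<omega>. neg_power b 0 (hitting_time b c R \<omega>) \<partial>M) = 1"
proof -
  define S where "S n = 1 / real (Suc n)" for n
  have c: "c > 0" using b_pos b_less_c by simp
  have S: "filterlim S (at_right 0) sequentially"
    unfolding S_def by real_asymp
  have S0: "S \<longlonglongrightarrow> 0" unfolding S_def by real_asymp
  have S_pos: "S n > 0" "S n \<le> 1" for n by (auto simp: S_def)
  have "(\<lambda>n. \<integral>\<omega>. neg_power b (S n) (hitting_time b c R \<omega>) \<partial>M)
      \<longlonglongrightarrow> (\<integral>\<omega>. neg_power b 0 (hitting_time b c R \<omega>) \<partial>M)"
  proof (rule integral_dominated_convergence[where w = "\<lambda>_. max 1 (1 / b)"])
    show "AE \<omega> in M. (\<lambda>n. neg_power b (S n) (hitting_time b c R \<omega>)) \<longlonglongrightarrow> neg_power b 0 (hitting_time b c R \<omega>)"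
    proof (rule AE_I2)
      fix \<omega>
      have "b + real_of_ereal (hitting_time b c R \<omega>) > 0"
        using b_pos hitting_time_nonneg[of \<omega>] by (intro add_pos_nonneg real_of_ereal_pos)
      then show "(\<lambda>n. neg_power b (S n) (hitting_time b c R \<omega>)) \<longlonglongrightarrow> neg_power b 0 (hitting_time b c R \<omega>)"
        unfolding neg_power_def
        by (cases "hitting_time b c R \<omega> = \<infinity>") (auto intro!: tendsto_eq_intros S0)
    qed
    \<comment> \<open>One bound for all exponents in [-1, 0]: the extremes are 1 for b \<ge> 1 and 1
      / b for b < 1.\<close>
    have "b powr (- S n) \<le> max 1 (1 / b)" for n
    proof (cases "b \<ge> 1")
      case True
      then have "b powr (- S n) \<le> b powr 0" using S_pos[of n] by (intro powr_mono) auto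
      then show ?thesis using True by simp
    next
      case False
      then have "b powr (- S n) \<le> b powr (- 1)" using S_pos[of n] b_pos by (intro powr_mono') auto
      then show ?thesis using b_pos by (simp add: powr_minus_divide)
    qed
    then show "AE \<omega> in M. norm (neg_power b (S n) (hitting_time b c R \<omega>)) \<le> max 1 (1 / b)" for n
      using neg_power_bounds[OF hitting_time_nonneg less_imp_le[OF S_pos(1)[of n]]]
      by (intro AE_I2) (smt (verit) real_norm_def)
  qed (auto intro: neg_power_hitting_measurable)
  moreover have "(\<lambda>n. \<integral>\<omega>. neg_power b (S n) (hitting_time b c R \<omega>) \<partial>M) \<longlonglongrightarrow> c powr (- 0) * (1 / 1)"
    unfolding moment_formula[OF S_pos(1)] using c b_pos
    by (intro tendsto_intros S0 filterlim_compose[OF gamma_law_affine_powr_tendsto[OF \<nu>_pos] S]) auto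
  ultimately show ?thesis
    using LIMSEQ_unique c by fastforce
qed

end

theorem theorem2:
  fixes M :: "'w measure" and R :: "real \<Rightarrow> 'w \<Rightarrow> real" and \<nu> b c s :: real
  assumes "\<nu> > 0" and "0 < b" and "b < c"
    and "bessel_process M \<nu> 1 R"
    and "s \<ge> 0"
  shows "(LINT \<omega>|M. neg_power b s (hitting_time b c R \<omega>))
       = c powr (- s) * ((LINT x|gamma_law s. (1 + 2 * b * x) powr (- s + \<nu>))
                       / (LINT x|gamma_law s. (1 + 2 * c * x) powr (- s + \<nu>)))"
proof -
  from assms(4) obtain P where P: "transition_function P" "has_bessel_generator \<nu> P" "markov_process M P R"
    and M: "prob_space M" "\<And>\<omega>. \<omega> \<in> space M \<Longrightarrow> continuous_on {0..} (\<lambda>u. R u \<omega>)" "AE \<omega> in M. R 0 \<omega> = 1"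
    unfolding bessel_process_def by blast
  interpret prob_space M by (rule M)
  interpret bessel_path \<nu> P M R b c
    by unfold_locales (use assms P M in auto)
  show ?thesis
  proof (cases "s = 0")
    case True
    \<comment> \<open>The law with parameter 0 is the point mass at 0, where the integrand is
      \<open>1 powr \<nu>\<close>; both expectations on the right-hand side are therefore 1.\<close>
    have "(LINT x|gamma_law 0. (1 + 2 * a * x) powr (- 0 + \<nu>)) = 1" for a
      by (simp add: gamma_law_def integral_return)
    then show ?thesis using True hitting_probability assms by simp
  next
    case False
    then show ?thesis using assms by (intro moment_formula) simp
  qed
qed

end
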